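(* Let $\mathcal C$ be a preadditive strict monoidal category. For any pre-braided object $(V,\sigma)$ in $\mathcal C$ with braided co-characters $e$ and $f$, a bidegree $1$ tensor bidifferential for $V$ is defined by $$({}_ed)^n:=\mathrm{sh}_{-\sigma}^{1,n}\circ(e\otimes\mathrm{Id}_{V^{\otimes n}}),\qquad(d_f)^n:=(-1)^n\,\mathrm{sh}_{-\sigma}^{n,1}\circ(\mathrm{Id}_{V^{\otimes n}}\otimes f)\qquad(n\ge0),$$ as morphisms $V^{\otimes n}\to V^{\otimes(n+1)}$.
   Context: In a preadditive monoidal category with unit object $\mathbf I$, $\otimes$ is additive in each variable; $V^{\otimes0}=\mathbf I$. For $\varphi:V^{\otimes l}\to V^{\otimes r}$, $\varphi_i=\mathrm{Id}_{V^{\otimes(i-1)}}\otimes\varphi\otimes\mathrm{Id}$. A pre-braided object is an object $V$ with a morphism $\sigma:V\otimes V\to V\otimes V$ (not necessarily invertible) such that $\sigma_1\sigma_2\sigma_1=\sigma_2\sigma_1\sigma_2$ on $V^{\otimes3}$; then $(V,-\sigma)$ is pre-braided as well. A braided co-character is a morphism $e:\mathbf I\to V$ with $\sigma\circ(e\otimes e)=e\otimes e$. For a pre-braiding $\beta$ and $s\in S_n$ with shortest expression $s=\tau_{i_1}\cdots\tau_{i_k}$ in adjacent transpositions $\tau_i=(i\ i{+}1)$, $T_s^{\beta}=\beta_{i_1}\circ\cdots\circ\beta_{i_k}$ on $V^{\otimes n}$. With $Sh_{p,q}=\{s\in S_{p+q}: s(1)<\dots<s(p),\ s(p+1)<\dots<s(p+q)\}$,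 the quantum shuffle multiplication has components $\mathrm{sh}_{\beta}^{p,q}=\sum_{s\in Sh_{p,q}}T^{\beta}_{s}:V^{\otimes p}\otimes V^{\otimes q}\to V^{\otimes(p+q)}$. A bidegree $1$ tensor bidifferential for $V$ is a pair of families $d^n,d'^n:V^{\otimes n}\to V^{\otimes(n+1)}$ ($n\ge0$) with $d^{n+1}d^n=d'^{n+1}d'^n=d'^{n+1}d^n+d^{n+1}d'^n=0$ for all $n\ge0$. *)

theory Defs
  imports "HOL-Algebra.Ring" "HOL-Combinatorics.Permutations"
begin

section \<open>Preadditive strict monoidal categories\<close>

text \<open>
  Each hom-set carries an abelian group structure. As usual in HOL-Algebra, additive abelian groups
  are presented by the type of rings, of which the fields for the multiplication and for the
  multiplicative unit are irrelevant: the locale \<^locale>\<open>abelian_group\<close> does not constrain them.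
\<close>

record ('o, 'm) monoidal_cat =
  Ob :: "'o set"
  Hom :: "'o \<Rightarrow> 'o \<Rightarrow> 'm ring"
  ident :: "'o \<Rightarrow> 'm"  ("Id\<^sub>c\<index>")
  compos :: "'m \<Rightarrow> 'm \<Rightarrow> 'm"  (infixr "\<circ>\<^sub>c\<index>" 55)
  tensor_ob :: "'o \<Rightarrow> 'o \<Rightarrow> 'o"  (infixr "\<otimes>\<^sub>o\<index>" 70)
  tensor_mor :: "'m \<Rightarrow> 'm \<Rightarrow> 'm"  (infixr "\<otimes>\<^sub>m\<index>" 70)
  unit_ob :: "'o"  ("\<I>\<index>")

definition mor :: "('o, 'm, 'x) monoidal_cat_scheme \<Rightarrow> 'o \<Rightarrow> 'o \<Rightarrow> 'm set" where
  "mor C A B = carrier (Hom C A B)"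

locale preadditive_category =
  fixes C :: "('o, 'm, 'x) monoidal_cat_scheme" (structure)
  assumes hom_disjoint:
      "\<lbrakk>A \<in> Ob C; B \<in> Ob C; A' \<in> Ob C; B' \<in> Ob C; f \<in> mor C A B; f \<in> mor C A' B'\<rbrakk>
        \<Longrightarrow> A = A' \<and> B = B'"
    and ident_closed: "A \<in> Ob C \<Longrightarrow> Id\<^sub>c A \<in> mor C A A"
    and comp_closed:
      "\<lbrakk>A \<in> Ob C; B \<in> Ob C; D \<in> Ob C; f \<in> mor C A B; g \<in> mor C B D\<rbrakk>
        \<Longrightarrow> g \<circ>\<^sub>c f \<in> mor C A D"
    and comp_ident_right: "\<lbrakk>A \<in> Ob C; B \<in> Ob C; f \<in> mor C A B\<rbrakk> \<Longrightarrow> f \<circ>\<^sub>c Id\<^sub>c A = f"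
    and comp_ident_left: "\<lbrakk>A \<in> Ob C; B \<in> Ob C; f \<in> mor C A B\<rbrakk> \<Longrightarrow> Id\<^sub>c B \<circ>\<^sub>c f = f"
    and comp_assoc:
      "\<lbrakk>A \<in> Ob C; B \<in> Ob C; D \<in> Ob C; E \<in> Ob C; f \<in> mor C A B; g \<in> mor C B D; h \<in> mor C D E\<rbrakk>
        \<Longrightarrow> (h \<circ>\<^sub>c g) \<circ>\<^sub>c f = h \<circ>\<^sub>c (g \<circ>\<^sub>c f)"
    and hom_abelian_group: "\<lbrakk>A \<in> Ob C; B \<in> Ob C\<rbrakk> \<Longrightarrow> abelian_group (Hom C A B)"
    and comp_add_right:
      "\<lbrakk>A \<in> Ob C; B \<in> Ob C; D \<in> Ob C; f \<in> mor C A B; f' \<in> mor C A B; g \<in> mor C B D\<rbrakk>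
        \<Longrightarrow> g \<circ>\<^sub>c (f \<oplus>\<^bsub>Hom C A B\<^esub> f') = (g \<circ>\<^sub>c f) \<oplus>\<^bsub>Hom C A D\<^esub> (g \<circ>\<^sub>c f')"
    and comp_add_left:
      "\<lbrakk>A \<in> Ob C; B \<in> Ob C; D \<in> Ob C; f \<in> mor C A B; g \<in> mor C B D; g' \<in> mor C B D\<rbrakk>
        \<Longrightarrow> (g \<oplus>\<^bsub>Hom C B D\<^esub> g') \<circ>\<^sub>c f = (g \<circ>\<^sub>c f) \<oplus>\<^bsub>Hom C A D\<^esub> (g' \<circ>\<^sub>c f)"

locale preadditive_strict_monoidal_category = preadditive_category +
  assumes unit_closed: "\<I> \<in> Ob C"
    and tensor_ob_closed: "\<lbrakk>A \<in> Ob C; B \<in> Ob C\<rbrakk> \<Longrightarrow> A \<otimes>\<^sub>o B \<in> Ob C"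
    and tensor_mor_closed:
      "\<lbrakk>A \<in> Ob C; B \<in> Ob C; A' \<in> Ob C; B' \<in> Ob C; f \<in> mor C A B; g \<in> mor C A' B'\<rbrakk>
        \<Longrightarrow> f \<otimes>\<^sub>m g \<in> mor C (A \<otimes>\<^sub>o A') (B \<otimes>\<^sub>o B')"
    and tensor_ident: "\<lbrakk>A \<in> Ob C; B \<in> Ob C\<rbrakk> \<Longrightarrow> Id\<^sub>c A \<otimes>\<^sub>m Id\<^sub>c B = Id\<^sub>c (A \<otimes>\<^sub>o B)"
    and tensor_comp:
      "\<lbrakk>A \<in> Ob C; B \<in> Ob C; D \<in> Ob C; A' \<in> Ob C; B' \<in> Ob C; D' \<in> Ob C;
        f \<in> mor C A B; g \<in> mor C B D; f' \<in> mor C A' B'; g' \<in> mor C B' D'\<rbrakk>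
        \<Longrightarrow> (g \<circ>\<^sub>c f) \<otimes>\<^sub>m (g' \<circ>\<^sub>c f') = (g \<otimes>\<^sub>m g') \<circ>\<^sub>c (f \<otimes>\<^sub>m f')"
    and tensor_ob_assoc:
      "\<lbrakk>A \<in> Ob C; B \<in> Ob C; D \<in> Ob C\<rbrakk> \<Longrightarrow> (A \<otimes>\<^sub>o B) \<otimes>\<^sub>o D = A \<otimes>\<^sub>o (B \<otimes>\<^sub>o D)"
    and tensor_ob_unit_left: "A \<in> Ob C \<Longrightarrow> \<I> \<otimes>\<^sub>o A = A"
    and tensor_ob_unit_right: "A \<in> Ob C \<Longrightarrow> A \<otimes>\<^sub>o \<I> = A"
    and tensor_mor_assoc:
      "\<lbrakk>A \<in> Ob C; B \<in> Ob C; A' \<in> Ob C; B' \<in> Ob C; A'' \<in> Ob C; B'' \<in> Ob C;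
        f \<in> mor C A B; g \<in> mor C A' B'; h \<in> mor C A'' B''\<rbrakk>
        \<Longrightarrow> (f \<otimes>\<^sub>m g) \<otimes>\<^sub>m h = f \<otimes>\<^sub>m (g \<otimes>\<^sub>m h)"
    and tensor_mor_unit_left: "\<lbrakk>A \<in> Ob C; B \<in> Ob C; f \<in> mor C A B\<rbrakk> \<Longrightarrow> Id\<^sub>c \<I> \<otimes>\<^sub>m f = f"
    and tensor_mor_unit_right: "\<lbrakk>A \<in> Ob C; B \<in> Ob C; f \<in> mor C A B\<rbrakk> \<Longrightarrow> f \<otimes>\<^sub>m Id\<^sub>c \<I> = f"
    and tensor_add_left:
      "\<lbrakk>A \<in> Ob C; B \<in> Ob C; A' \<in> Ob C; B' \<in> Ob C;
        f \<in> mor C A B; f' \<in> mor C A B; g \<in> mor C A' B'\<rbrakk>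
        \<Longrightarrow> (f \<oplus>\<^bsub>Hom C A B\<^esub> f') \<otimes>\<^sub>m g =
            (f \<otimes>\<^sub>m g) \<oplus>\<^bsub>Hom C (A \<otimes>\<^sub>o A') (B \<otimes>\<^sub>o B')\<^esub> (f' \<otimes>\<^sub>m g)"
    and tensor_add_right:
      "\<lbrakk>A \<in> Ob C; B \<in> Ob C; A' \<in> Ob C; B' \<in> Ob C;
        f \<in> mor C A B; g \<in> mor C A' B'; g' \<in> mor C A' B'\<rbrakk>
        \<Longrightarrow> f \<otimes>\<^sub>m (g \<oplus>\<^bsub>Hom C A' B'\<^esub> g') =
            (f \<otimes>\<^sub>m g) \<oplus>\<^bsub>Hom C (A \<otimes>\<^sub>o A') (B \<otimes>\<^sub>o B')\<^esub> (f \<otimes>\<^sub>m g')"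


section \<open>Pre-braided objects and braided co-characters\<close>

primrec tensor_power :: "('o, 'm, 'x) monoidal_cat_scheme \<Rightarrow> 'o \<Rightarrow> nat \<Rightarrow> 'o" where
  "tensor_power C V 0 = \<I>\<^bsub>C\<^esub>"
| "tensor_power C V (Suc n) = V \<otimes>\<^sub>o\<^bsub>C\<^esub> tensor_power C V n"

text \<open>
  The morphism \<open>\<phi>\<^sub>i\<close> on the \<open>n\<close>-th tensor power of \<open>V\<close>, where the source of \<open>\<phi>\<close> is
  the \<open>l\<close>-th one. It is meaningful for \<open>1 \<le> i\<close> and \<open>i + l \<le> n + 1\<close>.
\<close>

definition act_at ::
  "('o, 'm, 'x) monoidal_cat_scheme \<Rightarrow> 'o \<Rightarrow> nat \<Rightarrow> nat \<Rightarrow> 'm \<Rightarrow> nat \<Rightarrow> 'm" where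
  "act_at C V n l \<phi> i =
     Id\<^sub>c\<^bsub>C\<^esub> (tensor_power C V (i - 1)) \<otimes>\<^sub>m\<^bsub>C\<^esub> \<phi> \<otimes>\<^sub>m\<^bsub>C\<^esub>
     Id\<^sub>c\<^bsub>C\<^esub> (tensor_power C V (n - (i - 1) - l))"

definition pre_braided :: "('o, 'm, 'x) monoidal_cat_scheme \<Rightarrow> 'o \<Rightarrow> 'm \<Rightarrow> bool" where
  "pre_braided C V \<sigma> \<longleftrightarrow>
     V \<in> Ob C \<and>
     \<sigma> \<in> mor C (V \<otimes>\<^sub>o\<^bsub>C\<^esub> V) (V \<otimes>\<^sub>o\<^bsub>C\<^esub> V) \<and>
     (let \<sigma>\<^sub>1 = act_at C V 3 2 \<sigma> 1; \<sigma>\<^sub>2 = act_at C V 3 2 \<sigma> 2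
      in \<sigma>\<^sub>1 \<circ>\<^sub>c\<^bsub>C\<^esub> \<sigma>\<^sub>2 \<circ>\<^sub>c\<^bsub>C\<^esub> \<sigma>\<^sub>1 = \<sigma>\<^sub>2 \<circ>\<^sub>c\<^bsub>C\<^esub> \<sigma>\<^sub>1 \<circ>\<^sub>c\<^bsub>C\<^esub> \<sigma>\<^sub>2)"

definition neg_braiding :: "('o, 'm, 'x) monoidal_cat_scheme \<Rightarrow> 'o \<Rightarrow> 'm \<Rightarrow> 'm" where
  "neg_braiding C V \<sigma> = \<ominus>\<^bsub>Hom C (V \<otimes>\<^sub>o\<^bsub>C\<^esub> V) (V \<otimes>\<^sub>o\<^bsub>C\<^esub> V)\<^esub> \<sigma>"

definition braided_cocharacter ::
  "('o, 'm, 'x) monoidal_cat_scheme \<Rightarrow> 'o \<Rightarrow> 'm \<Rightarrow> 'm \<Rightarrow> bool" where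
  "braided_cocharacter C V \<sigma> e \<longleftrightarrow>
     e \<in> mor C \<I>\<^bsub>C\<^esub> V \<and> \<sigma> \<circ>\<^sub>c\<^bsub>C\<^esub> (e \<otimes>\<^sub>m\<^bsub>C\<^esub> e) = e \<otimes>\<^sub>m\<^bsub>C\<^esub> e"


section \<open>Quantum shuffle multiplication\<close>

text \<open>
  A list \<open>[i\<^sub>1, \<dots>, i\<^sub>k]\<close> stands for the product of the adjacent transpositions
  \<open>(i\<^sub>1 i\<^sub>1+1) \<dots> (i\<^sub>k i\<^sub>k+1)\<close>; products in the symmetric group are compositions of maps.
\<close>

definition word_perm :: "nat list \<Rightarrow> nat \<Rightarrow> nat" where
  "word_perm w = foldr (\<lambda>i s. transpose i (i + 1) \<circ> s) w id"

definition expresses :: "nat \<Rightarrow> (nat \<Rightarrow> nat) \<Rightarrow> nat list \<Rightarrow> bool" where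
  "expresses n s w \<longleftrightarrow> set w \<subseteq> {1..<n} \<and> word_perm w = s"

text \<open>
  \<open>arg_min\<close> selects some shortest expression of \<open>s\<close>. For a pre-braiding \<open>\<beta>\<close> the result does not
  depend on the selection, since any two shortest expressions are related by braid moves and by
  exchanges of commuting transpositions.
\<close>

definition braid_lift ::
  "('o, 'm, 'x) monoidal_cat_scheme \<Rightarrow> 'o \<Rightarrow> 'm \<Rightarrow> nat \<Rightarrow> (nat \<Rightarrow> nat) \<Rightarrow> 'm" where
  "braid_lift C V \<beta> n s =
     foldr (\<lambda>i g. act_at C V n 2 \<beta> i \<circ>\<^sub>c\<^bsub>C\<^esub> g) (arg_min length (expresses n s))
       (Id\<^sub>c\<^bsub>C\<^esub> (tensor_power C V n))"

definition shuffle_perms :: "nat \<Rightarrow> nat \<Rightarrow> (nat \<Rightarrow> nat) set" where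
  "shuffle_perms p q =
     {s. s permutes {1..p + q} \<and> strict_mono_on {1..p} s \<and> strict_mono_on {p + 1..p + q} s}"

definition quantum_shuffle ::
  "('o, 'm, 'x) monoidal_cat_scheme \<Rightarrow> 'o \<Rightarrow> 'm \<Rightarrow> nat \<Rightarrow> nat \<Rightarrow> 'm" where
  "quantum_shuffle C V \<beta> p q =
     finsum (Hom C (tensor_power C V (p + q)) (tensor_power C V (p + q)))
       (braid_lift C V \<beta> (p + q)) (shuffle_perms p q)"


section \<open>Bidegree 1 tensor bidifferentials\<close>

definition tensor_bidifferential ::
  "('o, 'm, 'x) monoidal_cat_scheme \<Rightarrow> 'o \<Rightarrow> (nat \<Rightarrow> 'm) \<Rightarrow> (nat \<Rightarrow> 'm) \<Rightarrow> bool" where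
  "tensor_bidifferential C V d d' \<longleftrightarrow>
     (\<forall>n. d n \<in> mor C (tensor_power C V n) (tensor_power C V (n + 1))) \<and>
     (\<forall>n. d' n \<in> mor C (tensor_power C V n) (tensor_power C V (n + 1))) \<and>
     (\<forall>n. let H = Hom C (tensor_power C V n) (tensor_power C V (n + 2))
          in d (n + 1) \<circ>\<^sub>c\<^bsub>C\<^esub> d n = \<zero>\<^bsub>H\<^esub> \<and>
             d' (n + 1) \<circ>\<^sub>c\<^bsub>C\<^esub> d' n = \<zero>\<^bsub>H\<^esub> \<and>
             (d' (n + 1) \<circ>\<^sub>c\<^bsub>C\<^esub> d n) \<oplus>\<^bsub>H\<^esub> (d (n + 1) \<circ>\<^sub>c\<^bsub>C\<^esub> d' n) = \<zero>\<^bsub>H\<^esub>)"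

definition left_differential ::
  "('o, 'm, 'x) monoidal_cat_scheme \<Rightarrow> 'o \<Rightarrow> 'm \<Rightarrow> 'm \<Rightarrow> nat \<Rightarrow> 'm" where
  "left_differential C V \<sigma> e n =
     quantum_shuffle C V (neg_braiding C V \<sigma>) 1 n \<circ>\<^sub>c\<^bsub>C\<^esub>
       (e \<otimes>\<^sub>m\<^bsub>C\<^esub> Id\<^sub>c\<^bsub>C\<^esub> (tensor_power C V n))"

definition right_differential ::
  "('o, 'm, 'x) monoidal_cat_scheme \<Rightarrow> 'o \<Rightarrow> 'm \<Rightarrow> 'm \<Rightarrow> nat \<Rightarrow> 'm" where
  "right_differential C V \<sigma> f n =
     [((- 1 :: int) ^ n)] \<cdot>\<^bsub>Hom C (tensor_power C V n) (tensor_power C V (n + 1))\<^esub>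
       (quantum_shuffle C V (neg_braiding C V \<sigma>) n 1 \<circ>\<^sub>c\<^bsub>C\<^esub>
         (Id\<^sub>c\<^bsub>C\<^esub> (tensor_power C V n) \<otimes>\<^sub>m\<^bsub>C\<^esub> f))"

end

theory Submission
  imports Defs "HOL-Algebra.AbelCoset"
begin

text \<open>
  Put \<open>\<beta> = -\<sigma>\<close>. A shuffle of one strand with \<open>n\<close> others carries that strand to one of \<open>n + 1\<close>
  positions, and its only shortest expression is a chain of consecutive transpositions
  (\<open>shuffle_perms_left\<close>, \<open>shortest_descending\<close> and their right-hand versions). So the left
  differential inserts \<open>e\<close> at the left and sums over the products \<open>\<beta>\<^sub>j \<dots> \<beta>\<^sub>1\<close> with \<open>0 \<le> j \<le> n\<close>, and
  the right one inserts \<open>f\<close> at the right and sums over the products \<open>\<beta>\<^sub>j \<dots> \<beta>\<^sub>n\<close> with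
  \<open>1 \<le> j \<le> n + 1\<close>.

  In a composite of two differentials, the second insertion can be moved before the first shuffle
  (\<open>comp_slide\<close>). What remains are identities in the ring of endomorphisms of one tensor power, and
  these follow from the braid relations alone. For a square, the double sum is \<open>Q (1 + \<beta>\<^sub>1)\<close>
  (\<open>descent_sum_factor\<close>): the two inserted strands reach any pair of positions both with and without
  crossing each other first. As \<open>e\<close> is a braided co-character, \<open>\<beta> (e \<otimes> e) = -(e \<otimes> e)\<close>, so the square
  is zero. The right-hand case is the mirror image (\<open>ascent_sum_factor\<close>). For the mixed composites, the
  two double sums agree (\<open>descents_ascents_exchange\<close>): the inserted strands travel in
  opposite directions, and if they meet, their crossing can be assigned to either journey. Hence
  the two maps commute, and the signs \<open>(-1)^n\<close> turn this into
  anticommutation.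
\<close>

section \<open>Sums of lifted shuffles in a represented braid monoid\<close>

text \<open>
  Words in the generators are kept as lists, and not only as ring elements, because every identity
  below between products of generators is an identity between words up to braid moves, and words
  can be relabelled: by a shift, or by the reflection \<open>i \<mapsto> N + 1 - i\<close>.
\<close>

definition eval_word :: "('a, 'b) ring_scheme \<Rightarrow> (nat \<Rightarrow> 'a) \<Rightarrow> nat list \<Rightarrow> 'a" where
  "eval_word R b w = foldr (\<lambda>i g. b i \<otimes>\<^bsub>R\<^esub> g) w \<one>\<^bsub>R\<^esub>"

text \<open>
  The positive braid monoid on \<open>N + 1\<close> strands, represented in a ring. The endomorphisms of a tensor
  power of a pre-braided object are the intended model.
\<close>

locale braid_family = ring +
  fixes b :: "nat \<Rightarrow> 'a" and N :: nat
  assumes gen_closed [simp, intro]: "i \<in> {1..N} \<Longrightarrow> b i \<in> carrier R"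
    and gen_commute: "\<lbrakk>1 \<le> i; i + 2 \<le> k; k \<le> N\<rbrakk> \<Longrightarrow> b i \<otimes> b k = b k \<otimes> b i"
    and gen_braid: "\<lbrakk>1 \<le> i; Suc i \<le> N\<rbrakk>
      \<Longrightarrow> b i \<otimes> (b (Suc i) \<otimes> b i) = b (Suc i) \<otimes> (b i \<otimes> b (Suc i))"
begin

abbreviation ev :: "nat list \<Rightarrow> 'a" where
  "ev \<equiv> eval_word R b"

lemma ev_Nil [simp]: "ev [] = \<one>"
  and ev_Cons [simp]: "ev (i # w) = b i \<otimes> ev w"
  by (simp_all add: eval_word_def)

lemma ev_closed [simp, intro]: "set w \<subseteq> {1..N} \<Longrightarrow> ev w \<in> carrier R"
  by (induction w) (auto intro!: gen_closed)

lemma ev_append: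
  "\<lbrakk>set u \<subseteq> {1..N}; set v \<subseteq> {1..N}\<rbrakk> \<Longrightarrow> ev (u @ v) = ev u \<otimes> ev v"
  by (induction u) (auto simp: m_assoc gen_closed)

lemma slide_mult:
  assumes "x \<in> carrier R" "y \<in> carrier R" "y' \<in> carrier R" "z \<in> carrier R" "z' \<in> carrier R"
    and "x \<otimes> y = y' \<otimes> x" "x \<otimes> z = z' \<otimes> x"
  shows "x \<otimes> (y \<otimes> z) = (y' \<otimes> z') \<otimes> x"
proof -
  have "x \<otimes> (y \<otimes> z) = (y' \<otimes> x) \<otimes> z"
    using assms(1-5) by (simp add: assms(6) flip: m_assoc)
  also have "\<dots> = (y' \<otimes> z') \<otimes> x"
    using assms(1-5) by (simp add: assms(7) m_assoc)
  finally show ?thesis .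
qed

lemma ev_commute_gen:
  assumes "set w \<subseteq> {1..N}" "1 \<le> i" "i \<le> N" "\<And>k. k \<in> set w \<Longrightarrow> i + 2 \<le> k \<or> k + 2 \<le> i"
  shows "b i \<otimes> ev w = ev w \<otimes> b i"
  using assms
proof (induction w)
  case Nil
  then show ?case by (simp add: gen_closed)
next
  case (Cons k w)
  have k: "b k \<in> carrier R" "b i \<in> carrier R" "ev w \<in> carrier R"
    using Cons.prems by (auto intro!: gen_closed)
  have ik: "b i \<otimes> b k = b k \<otimes> b i"
  proof (cases "i + 2 \<le> k")
    case True
    then show ?thesis using Cons.prems by (intro gen_commute) auto
  next
    case False
    then have "k + 2 \<le> i" using Cons.prems(4)[of k] by simp
    then show ?thesis using Cons.prems by (intro gen_commute[symmetric]) auto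
  qed
  have "b i \<otimes> ev w = ev w \<otimes> b i"
    using Cons by auto
  then show ?case
    using k ik slide_mult by simp
qed

lemma ev_commute:
  assumes "set u \<subseteq> {1..N}" "set v \<subseteq> {1..N}"
    and "\<And>i k. \<lbrakk>i \<in> set u; k \<in> set v\<rbrakk> \<Longrightarrow> i + 2 \<le> k \<or> k + 2 \<le> i"
  shows "ev u \<otimes> ev v = ev v \<otimes> ev u"
  using assms
proof (induction u)
  case Nil
  then show ?case by simp
next
  case (Cons i u)
  have cl: "b i \<in> carrier R" "ev u \<in> carrier R" "ev v \<in> carrier R"
    using Cons.prems by (auto intro!: gen_closed)
  have IH: "ev u \<otimes> ev v = ev v \<otimes> ev u"
    using Cons by auto
  have "b i \<otimes> ev v = ev v \<otimes> b i"
    using Cons.prems by (intro ev_commute_gen) auto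
  then show ?case
    using cl IH slide_mult[of "ev v" "b i" "b i" "ev u" "ev u"] by simp
qed

text \<open>
  These three products are the lifts of shuffles: \<open>descent k\<close> carries the first strand over its
  \<open>k\<close> right neighbours, \<open>shifted_descent k\<close> does this for the second strand, and \<open>ascent j\<close> carries
  the last strand to position \<open>j\<close>. Hence \<open>shifted_descent\<close> is what a \<open>(1, n)\<close> shuffle becomes once a
  new strand is inserted at the left.
\<close>

definition descent :: "nat \<Rightarrow> 'a" where
  "descent k = ev (rev [1..<Suc k])"

definition shifted_descent :: "nat \<Rightarrow> 'a" where
  "shifted_descent k = ev (rev [2..<k + 2])"

definition ascent :: "nat \<Rightarrow> 'a" where
  "ascent j = ev [j..<Suc N]"

lemma descent_closed [simp]: "k \<le> N \<Longrightarrow> descent k \<in> carrier R"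
  unfolding descent_def by (rule ev_closed) auto

lemma shifted_descent_closed [simp]: "k < N \<Longrightarrow> shifted_descent k \<in> carrier R"
  unfolding shifted_descent_def by (rule ev_closed) auto

lemma ascent_closed [simp]: "1 \<le> j \<Longrightarrow> ascent j \<in> carrier R"
  unfolding ascent_def by (rule ev_closed) auto

lemma descent_0 [simp]: "descent 0 = \<one>"
  by (simp add: descent_def)

lemma descent_Suc: "descent (Suc k) = b (Suc k) \<otimes> descent k"
  by (simp add: descent_def)

lemma shifted_descent_snoc:
  assumes "k < N"
  shows "descent (Suc k) = shifted_descent k \<otimes> b 1"
proof -
  have "[1..<Suc (Suc k)] = 1 # [2..<k + 2]"
    by (simp add: upt_conv_Cons numeral_2_eq_2)
  then have "descent (Suc k) = ev (rev [2..<k + 2] @ [1])"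
    unfolding descent_def by simp
  also have "\<dots> = shifted_descent k \<otimes> ev [1]"
    unfolding shifted_descent_def using assms by (intro ev_append) auto
  finally show ?thesis
    using assms gen_closed[of 1] by simp
qed

text \<open>
  A crossing can be slid through the strand that is carried across it, and moves one place to the
  left because that strand leaves the left side of the crossing. All identities between sums of
  shuffles below rest on this consequence of the braid relation.
\<close>

lemma descent_slide_gen:
  assumes "2 \<le> i" "i \<le> k" "k \<le> N"
  shows "descent k \<otimes> b i = b (i - 1) \<otimes> descent k"
  using assms(2,3)
proof (induction k rule: dec_induct)
  case base
  define m where "m = i - 2"
  then have i: "i = Suc (Suc m)"
    using assms(1) by simp
  have cl: "b (Suc m) \<in> carrier R" "b (Suc (Suc m)) \<in> carrier R" "descent m \<in> carrier R"
    using base i by (auto intro!: gen_closed)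
  have "descent m \<otimes> b i = b i \<otimes> descent m"
    unfolding descent_def using base i
    by (intro ev_commute_gen[symmetric]) auto
  then have "descent i \<otimes> b i = (b i \<otimes> (b (Suc m) \<otimes> b i)) \<otimes> descent m"
    using cl i by (simp add: descent_Suc m_assoc)
  also have "\<dots> = (b (Suc m) \<otimes> (b i \<otimes> b (Suc m))) \<otimes> descent m"
    using gen_braid[of "Suc m"] base i by simp
  also have "\<dots> = b (i - 1) \<otimes> descent i"
    using cl i by (simp add: descent_Suc m_assoc)
  finally show ?case .
next
  case (step k)
  have cl: "b i \<in> carrier R" "b (i - 1) \<in> carrier R" "b (Suc k) \<in> carrier R" "descent k \<in> carrier R"
    using step assms(1) by (auto intro!: gen_closed)
  have IH: "descent k \<otimes> b i = b (i - 1) \<otimes> descent k"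
    using step by simp
  have far: "b (i - 1) \<otimes> b (Suc k) = b (Suc k) \<otimes> b (i - 1)"
    using step assms(1) by (intro gen_commute) auto
  have "descent (Suc k) \<otimes> b i = b (Suc k) \<otimes> (b (i - 1) \<otimes> descent k)"
    using cl by (simp add: descent_Suc m_assoc IH)
  also have "\<dots> = b (i - 1) \<otimes> descent (Suc k)"
    using cl by (simp only: descent_Suc far m_assoc[symmetric])
  finally show ?case .
qed

lemma descent_slide:
  assumes "k \<le> N" "set w \<subseteq> {1..<k}"
  shows "descent k \<otimes> ev (map Suc w) = ev w \<otimes> descent k"
  using assms(2)
proof (induction w)
  case Nil
  then show ?case using assms(1) by simp
next
  case (Cons i w)
  have cl: "b i \<in> carrier R" "b (Suc i) \<in> carrier R" "descent k \<in> carrier R"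
      "ev w \<in> carrier R"
    using Cons.prems assms(1) by (auto intro!: gen_closed ev_closed)
  have cl': "ev (map Suc w) \<in> carrier R"
    using Cons.prems assms(1) by (intro ev_closed) fastforce
  have "descent k \<otimes> b (Suc i) = b i \<otimes> descent k"
    using descent_slide_gen[of "Suc i" k] Cons.prems assms(1) by simp
  moreover have "descent k \<otimes> ev (map Suc w) = ev w \<otimes> descent k"
    using Cons by simp
  ultimately show ?case
    using cl cl' slide_mult by simp
qed

lemma map_Suc_rev_upt: "map Suc (rev [m..<n]) = rev [Suc m..<Suc n]"
  by (simp add: map_Suc_upt flip: rev_map)

text \<open>
  Carrying strand 2 to position \<open>j + 2\<close> and then strand 1 over it to \<open>k + 2\<close> is the same as letting
  the two strands cross first and carrying them to the same places in the other order. Hence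
  in the double sum of the products \<open>descent j \<otimes> shifted_descent k\<close>, the term \<open>(k + 1, j)\<close> is the term
  \<open>(j, k)\<close> times \<open>b 1\<close>.
\<close>

lemma descent_shifted_descent:
  assumes "j \<le> k" "k < N"
  shows "descent (Suc k) \<otimes> shifted_descent j = descent j \<otimes> (shifted_descent k \<otimes> b 1)"
proof -
  have "shifted_descent j = ev (map Suc (rev [1..<Suc j]))"
    unfolding shifted_descent_def map_Suc_rev_upt by (simp add: numeral_2_eq_2)
  moreover have "set (rev [1..<Suc j]) \<subseteq> {1..<Suc k}"
    using assms by auto
  ultimately have "descent (Suc k) \<otimes> shifted_descent j = ev (rev [1..<Suc j]) \<otimes> descent (Suc k)"
    using assms descent_slide[of "Suc k" "rev [1..<Suc j]"] by (simp only: Suc_le_eq)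
  then show ?thesis
    using shifted_descent_snoc[of k] assms by (simp only: descent_def)
qed

text \<open>
  The terms \<open>descent j \<otimes> shifted_descent k\<close> with \<open>j > k\<close> are those with \<open>j \<le> k\<close> multiplied by \<open>b 1\<close>.
  In the application \<open>b 1\<close> acts as \<open>-1\<close> on the two inserted strands, so that the right factor
  \<open>\<one> \<oplus> b 1\<close> makes the composite vanish. The induction on \<open>M\<close> adds one row and one column of the
  double sum at a time: the new row equals the new column times \<open>b 1\<close>.
\<close>

lemma descent_sum_factor:
  assumes "N \<ge> 1"
  shows "\<exists>Q \<in> carrier R. (\<Oplus>j\<in>{..N}. descent j) \<otimes> (\<Oplus>k\<in>{..<N}. shifted_descent k) = Q \<otimes> (\<one> \<oplus> b 1)"
proof -
  have b1: "b 1 \<in> carrier R"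
    using assms gen_closed by simp
  have "\<exists>Q \<in> carrier R. (\<Oplus>j\<in>{..M}. descent j) \<otimes> (\<Oplus>k\<in>{..<M}. shifted_descent k) = Q \<otimes> (\<one> \<oplus> b 1)"
    if "M \<le> N" for M
    using that
  proof (induction M)
    case 0
    then show ?case using b1 by (intro bexI[of _ \<zero>]) auto
  next
    case (Suc M)
    let ?P = "\<lambda>m. \<Oplus>j\<in>{..m}. descent j" and ?S = "\<lambda>m. \<Oplus>k\<in>{..<m}. shifted_descent k"
    let ?q = "shifted_descent M"
    obtain Q where Q: "Q \<in> carrier R" "?P M \<otimes> ?S M = Q \<otimes> (\<one> \<oplus> b 1)"
      using Suc by auto
    have cl: "?P M \<in> carrier R" "?S M \<in> carrier R" "?q \<in> carrier R" "?S (Suc M) \<in> carrier R"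
        "descent (Suc M) \<in> carrier R"
      using Suc.prems by (auto intro!: finsum_closed)
    have P: "?P (Suc M) = descent (Suc M) \<oplus> ?P M"
      using Suc.prems by (intro finsum_Suc) auto
    have S: "?S (Suc M) = ?q \<oplus> ?S M"
      unfolding lessThan_Suc using Suc.prems by (intro finsum_insert) auto
    have "descent (Suc M) \<otimes> ?S (Suc M) = (\<Oplus>k\<in>{..M}. descent (Suc M) \<otimes> shifted_descent k)"
      using Suc.prems cl unfolding lessThan_Suc_atMost by (intro finsum_rdistr) auto
    also have "\<dots> = (\<Oplus>j\<in>{..M}. descent j \<otimes> (?q \<otimes> b 1))"
      using Suc.prems b1 cl
      by (intro finsum_cong'[OF refl _ descent_shifted_descent]) auto
    also have "\<dots> = ?P M \<otimes> (?q \<otimes> b 1)"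
      using Suc.prems b1 cl by (intro finsum_ldistr[symmetric]) auto
    finally have "descent (Suc M) \<otimes> ?S (Suc M) = ?P M \<otimes> (?q \<otimes> b 1)" .
    then have "?P (Suc M) \<otimes> ?S (Suc M) = ?P M \<otimes> (?q \<otimes> b 1) \<oplus> ?P M \<otimes> (?q \<oplus> ?S M)"
      unfolding P using cl by (simp add: l_distr S[symmetric])
    also have "\<dots> = (?P M \<otimes> ?q \<oplus> Q) \<otimes> (\<one> \<oplus> b 1)"
      using cl b1 Q by (simp add: l_distr r_distr m_assoc a_ac)
    finally show ?case
      using cl Q by (intro bexI[of _ "?P M \<otimes> ?q \<oplus> Q"]) auto
  qed
  from this[OF order_refl] show ?thesis .
qed

text \<open>
  If the path of the last strand meets the path of the first one, their crossing \<open>b (Suc k)\<close> can be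
  attributed to either of them. This is why both indices drop by one when the order changes.
\<close>

lemma descent_ascent_near:
  assumes "1 \<le> j" "j \<le> Suc k" "Suc k \<le> N"
  shows "descent (Suc k) \<otimes> ascent (Suc j) = ascent j \<otimes> descent k"
proof -
  let ?h = "ev [j..<Suc k]" and ?t = "ev [Suc (Suc k)..<Suc N]"
  have cl: "?h \<in> carrier R" "?t \<in> carrier R" "b (Suc k) \<in> carrier R" "descent k \<in> carrier R"
      "ev (map Suc [j..<Suc k]) \<in> carrier R"
    using assms by (auto intro!: gen_closed ev_closed)
  have "[Suc j..<Suc N] = map Suc [j..<Suc k] @ [Suc (Suc k)..<Suc N]"
    using assms upt_add_eq_append[of "Suc j" "Suc (Suc k)" "N - Suc k"] by (simp add: map_Suc_upt)
  then have asc: "ascent (Suc j) = ev (map Suc [j..<Suc k]) \<otimes> ?t"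
    unfolding ascent_def using assms by (simp only:) (intro ev_append; auto)
  have "[j..<Suc N] = [j..<Suc k] @ [Suc k] @ [Suc (Suc k)..<Suc N]"
    using assms upt_add_eq_append[of j "Suc k" "N - k"] by (simp add: upt_conv_Cons)
  then have asc': "ascent j = ?h \<otimes> (b (Suc k) \<otimes> ?t)"
    unfolding ascent_def using assms ev_append[of "[j..<Suc k]" "[Suc k] @ [Suc (Suc k)..<Suc N]"]
    by (simp only: append.simps ev_Cons set_upt set_simps) force
  have far: "descent k \<otimes> ?t = ?t \<otimes> descent k"
    unfolding descent_def using assms by (intro ev_commute) auto
  have slide: "descent (Suc k) \<otimes> ev (map Suc [j..<Suc k]) = ?h \<otimes> descent (Suc k)"
    using assms by (intro descent_slide) auto
  have "descent (Suc k) \<otimes> ascent (Suc j) = ?h \<otimes> descent (Suc k) \<otimes> ?t"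
    unfolding asc using cl assms by (simp only: m_assoc[symmetric] descent_closed slide)
  also have "\<dots> = ?h \<otimes> (b (Suc k) \<otimes> (?t \<otimes> descent k))"
    using cl by (simp only: descent_Suc m_assoc far m_closed)
  also have "\<dots> = ascent j \<otimes> descent k"
    using cl by (simp add: asc' m_assoc)
  finally show ?thesis .
qed

lemma descent_ascent_far:
  assumes "k \<le> N" "k + 2 \<le> j"
  shows "descent k \<otimes> ascent j = ascent j \<otimes> descent k"
proof (cases "j \<le> Suc N")
  case True
  then show ?thesis
    unfolding descent_def ascent_def using assms by (intro ev_commute) auto
next
  case False
  then show ?thesis using assms by (simp add: ascent_def)
qed

lemma ascent_sum_split:
  assumes "m \<le> l" "l \<le> Suc N" "1 \<le> m"
  shows "(\<Oplus>j\<in>{m..Suc N}. ascent j) = (\<Oplus>j\<in>{m..l}. ascent j) \<oplus> (\<Oplus>j\<in>{Suc l..Suc N}. ascent j)"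
proof -
  have "{m..Suc N} = {m..l} \<union> {Suc l..Suc N}"
    using assms by auto
  then show ?thesis
    using assms by (simp only:) (rule finsum_Un_disjoint; auto)
qed

lemma descent_times_ascents:
  assumes "Suc k \<le> N"
  shows "descent (Suc k) \<otimes> (\<Oplus>j\<in>{2..Suc N}. ascent j) =
    (\<Oplus>j\<in>{1..Suc k}. ascent j) \<otimes> descent k \<oplus> (\<Oplus>j\<in>{k + 3..Suc N}. ascent j) \<otimes> descent (Suc k)"
proof -
  have cl: "descent k \<in> carrier R" "descent (Suc k) \<in> carrier R"
    using assms by auto
  have asc: "ascent \<in> {2..k + 2} \<rightarrow> carrier R" "ascent \<in> {k + 3..Suc N} \<rightarrow> carrier R"
      "ascent \<in> {1..Suc k} \<rightarrow> carrier R"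
    by auto
  have "descent (Suc k) \<otimes> (\<Oplus>j\<in>{2..k + 2}. ascent j)
      = (\<Oplus>j\<in>{2..k + 2}. descent (Suc k) \<otimes> ascent j)"
    using cl asc by (intro finsum_rdistr) auto
  also have "{2..k + 2} = Suc ` {1..Suc k}"
    by (simp add: image_Suc_atLeastAtMost numeral_2_eq_2)
  also have "(\<Oplus>j\<in>Suc ` {1..Suc k}. descent (Suc k) \<otimes> ascent j)
      = (\<Oplus>j\<in>{1..Suc k}. descent (Suc k) \<otimes> ascent (Suc j))"
    using cl by (intro finsum_reindex) auto
  also have "\<dots> = (\<Oplus>j\<in>{1..Suc k}. ascent j \<otimes> descent k)"
    using cl assms by (intro finsum_cong'[OF refl _ descent_ascent_near]) auto
  also have "\<dots> = (\<Oplus>j\<in>{1..Suc k}. ascent j) \<otimes> descent k"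
    using cl by (intro finsum_ldistr[symmetric]) auto
  finally have near: "descent (Suc k) \<otimes> (\<Oplus>j\<in>{2..k + 2}. ascent j)
      = (\<Oplus>j\<in>{1..Suc k}. ascent j) \<otimes> descent k"
    by (simp add: image_Suc_atLeastAtMost numeral_2_eq_2)
  have "descent (Suc k) \<otimes> (\<Oplus>j\<in>{k + 3..Suc N}. ascent j)
      = (\<Oplus>j\<in>{k + 3..Suc N}. descent (Suc k) \<otimes> ascent j)"
    using cl asc by (intro finsum_rdistr) auto
  also have "\<dots> = (\<Oplus>j\<in>{k + 3..Suc N}. ascent j \<otimes> descent (Suc k))"
    using cl assms by (intro finsum_cong'[OF refl _ descent_ascent_far]) auto
  also have "\<dots> = (\<Oplus>j\<in>{k + 3..Suc N}. ascent j) \<otimes> descent (Suc k)"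
    using cl asc by (intro finsum_ldistr[symmetric]) auto
  finally have far: "descent (Suc k) \<otimes> (\<Oplus>j\<in>{k + 3..Suc N}. ascent j)
      = (\<Oplus>j\<in>{k + 3..Suc N}. ascent j) \<otimes> descent (Suc k)" .
  have "(\<Oplus>j\<in>{2..Suc N}. ascent j)
      = (\<Oplus>j\<in>{2..k + 2}. ascent j) \<oplus> (\<Oplus>j\<in>{k + 3..Suc N}. ascent j)"
    using ascent_sum_split[of 2 "k + 2"] assms by (simp add: numeral_3_eq_3)
  moreover have "(\<Oplus>j\<in>{2..k + 2}. ascent j) \<in> carrier R" "(\<Oplus>j\<in>{k + 3..Suc N}. ascent j) \<in> carrier R"
    using asc by (auto intro!: finsum_closed)
  ultimately show ?thesis
    using cl by (simp only: r_distr near far)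
qed

text \<open>
  Summing \<open>descent_times_ascents\<close> over \<open>k\<close> telescopes: the near part for \<open>k + 1\<close> completes the far part
  for \<open>k\<close> to the full sum of the ascents, so that only one far part remains, and it is empty for
  \<open>M = N\<close>.
\<close>

lemma descents_times_ascents:
  assumes "M \<le> N"
  shows "(\<Oplus>k\<in>{..M}. descent k) \<otimes> (\<Oplus>j\<in>{2..Suc N}. ascent j) =
    (\<Oplus>j\<in>{1..Suc N}. ascent j) \<otimes> (\<Oplus>k\<in>{..<M}. descent k)
      \<oplus> (\<Oplus>j\<in>{M + 2..Suc N}. ascent j) \<otimes> descent M"
  using assms
proof (induction M)
  case 0
  have "(\<Oplus>j\<in>{2..Suc N}. ascent j) \<in> carrier R" "(\<Oplus>j\<in>{1..Suc N}. ascent j) \<in> carrier R"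
    by (auto intro!: finsum_closed)
  then show ?case
    by (simp add: numeral_2_eq_2)
next
  case (Suc M)
  let ?A = "\<lambda>m l. \<Oplus>j\<in>{m..l}. ascent j" and ?D = "\<Oplus>k\<in>{..<M}. descent k"
  let ?R = "?A 1 (Suc N)" and ?R2 = "?A 2 (Suc N)" and ?T = "?A (M + 2) (Suc N)"
    and ?T' = "?A (M + 3) (Suc N)" and ?G = "?A 1 (Suc M)" and ?D' = "\<Oplus>k\<in>{..M}. descent k"
  have cl: "?R \<in> carrier R" "?R2 \<in> carrier R" "?T \<in> carrier R" "?T' \<in> carrier R" "?G \<in> carrier R"
      "?D \<in> carrier R" "?D' \<in> carrier R" "descent M \<in> carrier R" "descent (Suc M) \<in> carrier R"
    using Suc.prems by (auto intro!: finsum_closed)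
  have R: "?R = ?G \<oplus> ?T"
    using ascent_sum_split[of 1 "Suc M"] Suc.prems by (simp only:) simp
  have D': "?D' = descent M \<oplus> ?D"
    using Suc.prems by (intro add.finprod_Suc3) auto
  have "(\<Oplus>k\<in>{..Suc M}. descent k) = descent (Suc M) \<oplus> ?D'"
    using Suc.prems by (intro finsum_Suc) auto
  then have "(\<Oplus>k\<in>{..Suc M}. descent k) \<otimes> ?R2 = descent (Suc M) \<otimes> ?R2 \<oplus> ?D' \<otimes> ?R2"
    using cl by (simp only: l_distr)
  also have "\<dots> = (?G \<otimes> descent M \<oplus> ?T' \<otimes> descent (Suc M)) \<oplus> (?R \<otimes> ?D \<oplus> ?T \<otimes> descent M)"
    using Suc by (simp only: descent_times_ascents Suc_leD)
  also have "\<dots> = ?R \<otimes> ?D \<oplus> (?G \<oplus> ?T) \<otimes> descent M \<oplus> ?T' \<otimes> descent (Suc M)"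
    using cl by (simp only: l_distr m_closed a_ac a_closed)
  also have "\<dots> = ?R \<otimes> (descent M \<oplus> ?D) \<oplus> ?T' \<otimes> descent (Suc M)"
    unfolding R[symmetric] using cl by (simp only: r_distr m_closed a_ac a_closed)
  also have "\<dots> = ?R \<otimes> (\<Oplus>k\<in>{..<Suc M}. descent k) \<oplus> ?A (Suc M + 2) (Suc N) \<otimes> descent (Suc M)"
    unfolding D'[symmetric] lessThan_Suc_atMost by (simp add: numeral_3_eq_3)
  finally show ?case .
qed

lemma descents_ascents_exchange:
  "(\<Oplus>k\<in>{..N}. descent k) \<otimes> (\<Oplus>j\<in>{2..Suc N}. ascent j) =
    (\<Oplus>j\<in>{1..Suc N}. ascent j) \<otimes> (\<Oplus>k\<in>{..<N}. descent k)"
proof -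
  have "(\<Oplus>j\<in>{1..Suc N}. ascent j) \<otimes> (\<Oplus>k\<in>{..<N}. descent k) \<in> carrier R"
    by (intro m_closed finsum_closed) auto
  then show ?thesis
    using descents_times_ascents[OF order_refl] by simp
qed

text \<open>
  Reflecting the order of the strands turns descents into ascents, and so gives the statements about
  the right differential from those about the left one.
\<close>

lemma mirror: "braid_family R (\<lambda>i. b (Suc N - i)) N"
proof
  fix i assume "i \<in> {1..N}"
  then show "b (Suc N - i) \<in> carrier R" by (intro gen_closed) auto
next
  fix i k assume "1 \<le> i" "i + 2 \<le> k" "k \<le> N"
  then show "b (Suc N - i) \<otimes> b (Suc N - k) = b (Suc N - k) \<otimes> b (Suc N - i)"
    by (intro gen_commute[symmetric]) auto
next
  fix i assume i: "1 \<le> i" "Suc i \<le> N"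
  then have "Suc N - i = Suc (N - i)" "Suc N - Suc i = N - i"
    by auto
  then show "b (Suc N - i) \<otimes> (b (Suc N - Suc i) \<otimes> b (Suc N - i)) =
      b (Suc N - Suc i) \<otimes> (b (Suc N - i) \<otimes> b (Suc N - Suc i))"
    using i gen_braid[of "N - i"] by simp
qed

lemma map_diff_rev_upt:
  assumes "n \<le> Suc m"
  shows "map (\<lambda>i. m - i) (rev [l..<n]) = [Suc m - n..<Suc m - l]"
  using assms by (intro nth_equalityI) (auto simp: rev_nth)

lemma image_diff_lessThan:
  fixes m n :: nat
  assumes "n \<le> m"
  shows "(\<lambda>k. m - k) ` {..<n} = {Suc m - n..m}"
proof
  show "{Suc m - n..m} \<subseteq> (\<lambda>k. m - k) ` {..<n}"
  proof
    fix x assume "x \<in> {Suc m - n..m}"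
    then show "x \<in> (\<lambda>k. m - k) ` {..<n}"
      using assms by (intro image_eqI[of _ _ "m - x"]) auto
  qed
qed (use assms in auto)

lemma eval_mirror: "eval_word R (\<lambda>i. b (m - i)) w = ev (map (\<lambda>i. m - i) w)"
  by (simp add: eval_word_def foldr_map comp_def)

lemma ascent_sum_factor:
  assumes "N \<ge> 1"
  shows "\<exists>Q \<in> carrier R. (\<Oplus>j\<in>{1..Suc N}. ascent j) \<otimes> (\<Oplus>j\<in>{1..N}. ev [j..<N]) = Q \<otimes> (\<one> \<oplus> b N)"
proof -
  interpret m: braid_family R "\<lambda>i. b (Suc N - i)" N
    by (rule mirror)
  have "m.descent k = ascent (Suc N - k)" if "k \<le> N" for k
    unfolding m.descent_def eval_mirror ascent_def
    using that by (subst map_diff_rev_upt) auto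
  then have "(\<Oplus>k\<in>{..N}. m.descent k) = (\<Oplus>k\<in>{..N}. ascent (Suc N - k))"
    by (intro finsum_cong') auto
  also have "\<dots> = (\<Oplus>j\<in>(\<lambda>k. Suc N - k) ` {..N}. ascent j)"
    by (intro finsum_reindex[symmetric]) (auto simp: inj_on_def)
  also have "(\<lambda>k. Suc N - k) ` {..N} = {1..Suc N}"
    using image_diff_lessThan[of "Suc N" "Suc N"] by (simp add: lessThan_Suc_atMost)
  finally have D: "(\<Oplus>k\<in>{..N}. m.descent k) = (\<Oplus>j\<in>{1..Suc N}. ascent j)" .
  have evN: "ev [j..<N] \<in> carrier R" if "1 \<le> j" for j
    using that by (intro ev_closed) auto
  have "m.shifted_descent k = ev [N - k..<N]" if "k < N" for k
    unfolding m.shifted_descent_def eval_mirror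
    using that by (subst map_diff_rev_upt) auto
  then have "(\<Oplus>k\<in>{..<N}. m.shifted_descent k) = (\<Oplus>k\<in>{..<N}. ev [N - k..<N])"
    using evN by (intro finsum_cong') auto
  also have "\<dots> = (\<Oplus>j\<in>(\<lambda>k. N - k) ` {..<N}. ev [j..<N])"
    using evN by (intro finsum_reindex[symmetric]) (auto simp: inj_on_def)
  also have "(\<lambda>k. N - k) ` {..<N} = {1..N}"
    using image_diff_lessThan[of N N] by simp
  finally have S: "(\<Oplus>k\<in>{..<N}. m.shifted_descent k) = (\<Oplus>j\<in>{1..N}. ev [j..<N])" .
  show ?thesis
    using m.descent_sum_factor[OF assms] by (simp add: D S)
qed

end

section \<open>Shuffles of one strand with the others\<close>

lemma word_perm_Nil [simp]: "word_perm [] = id"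
  and word_perm_Cons [simp]: "word_perm (i # w) = transpose i (i + 1) \<circ> word_perm w"
  by (simp_all add: word_perm_def)

lemma transpose_Suc_cases:
  obtains "a = i" "transpose i (i + 1) a = Suc a" | "transpose i (i + 1) a \<le> a"
proof (cases "a = i")
  case False
  then show ?thesis using that(2) by (cases "a = Suc i") auto
qed (use that in auto)

text \<open>
  An adjacent transposition moves a point by at most one place. A word that carries \<open>a\<close> to
  \<open>a + length w\<close> has no letter to spare, so that its letters are forced. Hence a shuffle of one strand
  with the others has exactly one shortest expression.
\<close>

lemma word_perm_upper: "word_perm w a \<le> a + length w"
proof (induction w)
  case (Cons i w)
  then show ?case
    by (cases rule: transpose_Suc_cases[of "word_perm w a" i]) auto
qed simp

lemma word_perm_upper_unique:
  "word_perm w a = a + length w \<Longrightarrow> w = rev [a..<a + length w]"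
proof (induction w)
  case (Cons i w)
  have le: "word_perm w a \<le> a + length w"
    by (rule word_perm_upper)
  show ?case
  proof (cases rule: transpose_Suc_cases[of "word_perm w a" i])
    case 1
    with Cons.prems have "i = a + length w" "word_perm w a = a + length w"
      by auto
    then show ?thesis
      using Cons.IH by simp
  next
    case 2
    then show ?thesis using Cons.prems le by simp
  qed
qed simp

lemma transpose_Suc_cases':
  obtains "a = Suc i" "Suc (transpose i (i + 1) a) = a" | "a \<le> transpose i (i + 1) a"
proof (cases "a = Suc i")
  case False
  then show ?thesis using that(2) by (cases "a = i") auto
qed (use that in auto)

lemma word_perm_lower: "a \<le> word_perm w a + length w"
proof (induction w)
  case (Cons i w)
  then show ?case
    by (cases rule: transpose_Suc_cases'[of "word_perm w a" i]) auto
qed simp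

lemma word_perm_lower_unique:
  "word_perm w a + length w = a \<Longrightarrow> w = [word_perm w a..<a]"
proof (induction w)
  case (Cons i w)
  have le: "a \<le> word_perm w a + length w"
    by (rule word_perm_lower)
  show ?case
  proof (cases rule: transpose_Suc_cases'[of "word_perm w a" i])
    case 1
    with Cons.prems have i: "word_perm w a = Suc i" "word_perm (i # w) a = i"
        "word_perm w a + length w = a"
      by auto
    then have "w = [Suc i..<a]"
      using Cons.IH by simp
    moreover have "i < a"
      using i by simp
    ultimately show ?thesis
      unfolding i(2) by (simp only: upt_conv_Cons)
  next
    case 2
    then show ?thesis using Cons.prems le by simp
  qed
qed simp

lemma word_perm_rev_upt:
  assumes "a \<le> c"
  shows "word_perm (rev [a..<c]) x = (if x = a then c else if a < x \<and> x \<le> c then x - 1 else x)"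
  using assms
proof (induction c rule: dec_induct)
  case (step c)
  then show ?case by (auto simp: transpose_def)
qed auto

lemma word_perm_upt:
  assumes "a \<le> c"
  shows "word_perm [a..<c] x = (if x = c then a else if a \<le> x \<and> x < c then Suc x else x)"
  using assms
proof (induction a rule: inc_induct)
  case (step a)
  have "[a..<c] = a # [Suc a..<c]"
    using step by (simp add: upt_conv_Cons)
  then show ?case
    using step by (auto simp: transpose_def)
qed auto

lemma word_perm_permutes: "set w \<subseteq> {1..<n} \<Longrightarrow> word_perm w permutes {1..n}"
proof (induction w)
  case (Cons i w)
  then have "transpose i (i + 1) permutes {1..n}"
    by (intro permutes_swap_id) auto
  then show ?case
    unfolding word_perm_Cons using Cons by (intro permutes_compose) auto
qed (simp add: permutes_id)

lemma shortest_descending: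
  assumes "a \<le> c" "1 \<le> a" "c \<le> n"
  shows "arg_min length (expresses n (word_perm (rev [a..<c]))) = rev [a..<c]"
proof -
  let ?w = "rev [a..<c]" and ?E = "expresses n (word_perm (rev [a..<c]))"
  let ?m = "arg_min length ?E"
  have wE: "?E ?w"
    using assms by (auto simp: expresses_def)
  then have m: "?E ?m" "length ?m \<le> c - a"
    using arg_min_nat_lemma[of ?E ?w length] by auto
  then have "word_perm ?m a = c"
    using assms by (simp add: expresses_def word_perm_rev_upt)
  then have "a + length ?m = c"
    using word_perm_upper[of ?m a] m assms by simp
  then show ?thesis
    using word_perm_upper_unique[of ?m a] \<open>word_perm ?m a = c\<close> by simp
qed

lemma shortest_ascending:
  assumes "a \<le> c" "1 \<le> a" "c \<le> n"
  shows "arg_min length (expresses n (word_perm [a..<c])) = [a..<c]"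
proof -
  let ?w = "[a..<c]" and ?E = "expresses n (word_perm [a..<c])"
  let ?m = "arg_min length ?E"
  have wE: "?E ?w"
    using assms by (auto simp: expresses_def)
  then have m: "?E ?m" "length ?m \<le> c - a"
    using arg_min_nat_lemma[of ?E ?w length] by auto
  then have mc: "word_perm ?m c = a"
    using assms by (simp add: expresses_def word_perm_upt)
  then have "word_perm ?m c + length ?m = c"
    using word_perm_lower[of c ?m] m assms by simp
  then show ?thesis
    using word_perm_lower_unique[of ?m c] mc by simp
qed

text \<open>
  If \<open>f x\<close> were taken by \<open>g\<close> at a point before \<open>x\<close>, then \<open>f\<close> would take it twice.
\<close>

lemma strict_mono_on_image_le:
  fixes f g :: "'a :: wellorder \<Rightarrow> 'b :: linorder"
  assumes "strict_mono_on A f" "strict_mono_on A g" "f ` A = g ` A"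
    and "x \<in> A" "\<And>y. \<lbrakk>y \<in> A; y < x\<rbrakk> \<Longrightarrow> f y = g y"
  shows "g x \<le> f x"
proof -
  obtain y where y: "y \<in> A" "f x = g y"
    using assms(3,4) by blast
  have "x \<le> y"
  proof (rule ccontr)
    assume "\<not> x \<le> y"
    then have "y < x" "f y = f x"
      using assms(5) y by auto
    then show False
      using strict_mono_onD[OF assms(1) y(1) assms(4)] by simp
  qed
  then show ?thesis
    using strict_mono_on_leD[OF assms(2) assms(4) y(1)] y(2) by simp
qed

lemma strict_mono_on_image_unique:
  fixes f g :: "'a :: wellorder \<Rightarrow> 'b :: linorder"
  assumes "strict_mono_on A f" "strict_mono_on A g" "f ` A = g ` A" "x \<in> A"
  shows "f x = g x"
  using assms(4)
proof (induction x rule: less_induct)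
  case (less x)
  then show ?case
    using strict_mono_on_image_le[OF assms(1-3), of x]
      strict_mono_on_image_le[OF assms(2,1) assms(3)[symmetric], of x]
    by (metis order.antisym)
qed

text \<open>
  A shuffle of one point with all the others is determined by the image of that point, since an
  increasing map on the rest is determined by its image.
\<close>

lemma permutes_eq_if_mono_on_rest:
  fixes s t :: "nat \<Rightarrow> nat"
  assumes "s permutes S" "t permutes S" "a \<in> S" "s a = t a"
    and "strict_mono_on (S - {a}) s" "strict_mono_on (S - {a}) t"
  shows "s = t"
proof
  fix x
  have rest: "s ` (S - {a}) = S - {s a}" if "s permutes S" for s
    using permutes_image[OF that] permutes_inj[OF that] assms(3)
    by (simp add: image_set_diff)
  have "s ` (S - {a}) = t ` (S - {a})"
    using rest[OF assms(1)] rest[OF assms(2)] assms(4) by simp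
  then have "s x = t x" if "x \<in> S - {a}"
    using strict_mono_on_image_unique[OF assms(5,6)] that by blast
  moreover have "s x = x" "t x = x" if "x \<notin> S"
    using permutes_not_in[OF assms(1) that] permutes_not_in[OF assms(2) that] by auto
  ultimately show "s x = t x"
    using assms(4) by (cases "x = a"; cases "x \<in> S") auto
qed

lemma shuffle_perms_left:
  "shuffle_perms 1 n = (\<lambda>j. word_perm (rev [1..<Suc j])) ` {..n}"
proof
  have rest: "{1..1 + n} - {1} = {1 + 1..1 + n}"
    by auto
  have cyc: "word_perm (rev [1..<Suc j]) \<in> shuffle_perms 1 n" if "j \<le> n" for j
  proof -
    have "word_perm (rev [1..<Suc j]) permutes {1..1 + n}"
      using that by (intro word_perm_permutes) auto
    moreover have "strict_mono_on {1 + 1..1 + n} (word_perm (rev [1..<Suc j]))"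
      by (intro strict_mono_onI) (simp only: word_perm_rev_upt[of 1 "Suc j"], auto)
    moreover have "strict_mono_on {1..1} (word_perm (rev [1..<Suc j]))"
      by (intro strict_mono_onI) auto
    ultimately show ?thesis
      unfolding shuffle_perms_def by blast
  qed
  then show "(\<lambda>j. word_perm (rev [1..<Suc j])) ` {..n} \<subseteq> shuffle_perms 1 n"
    by blast
  show "shuffle_perms 1 n \<subseteq> (\<lambda>j. word_perm (rev [1..<Suc j])) ` {..n}"
  proof
    fix s assume s: "s \<in> shuffle_perms 1 n"
    define j where "j = s 1 - 1"
    have "s permutes {1..1 + n}"
      using s by (simp add: shuffle_perms_def)
    then have "s 1 \<in> {1..1 + n}"
      using permutes_in_image[of s "{1..1 + n}" 1] by simp
    then have j: "s 1 = Suc j" "j \<le> n"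
      by (auto simp: j_def)
    have "s = word_perm (rev [1..<Suc j])"
    proof (rule permutes_eq_if_mono_on_rest[of _ "{1..1 + n}" _ 1])
      show "s 1 = word_perm (rev [1..<Suc j]) 1"
        using j by (simp only: word_perm_rev_upt) simp
      show "strict_mono_on ({1..1 + n} - {1}) s" "strict_mono_on ({1..1 + n} - {1}) (word_perm (rev [1..<Suc j]))"
        unfolding rest using s cyc[OF j(2)] unfolding shuffle_perms_def by blast+
    qed (use s cyc[OF j(2)] in \<open>unfold shuffle_perms_def, auto\<close>)
    then show "s \<in> (\<lambda>j. word_perm (rev [1..<Suc j])) ` {..n}"
      using j by blast
  qed
qed

lemma shuffle_perms_right:
  "shuffle_perms n 1 = (\<lambda>j. word_perm [j..<Suc n]) ` {1..Suc n}"
proof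
  have rest: "{1..n + 1} - {n + 1} = {1..n}"
    by auto
  have cyc: "word_perm [j..<Suc n] \<in> shuffle_perms n 1" if "1 \<le> j" "j \<le> Suc n" for j
  proof -
    have "word_perm [j..<Suc n] permutes {1..n + 1}"
      using that by (intro word_perm_permutes) auto
    moreover have "strict_mono_on {1..n} (word_perm [j..<Suc n])"
      using that by (intro strict_mono_onI) (simp only: word_perm_upt, auto)
    moreover have "strict_mono_on {n + 1..n + 1} (word_perm [j..<Suc n])"
      by (intro strict_mono_onI) auto
    ultimately show ?thesis
      unfolding shuffle_perms_def by blast
  qed
  then show "(\<lambda>j. word_perm [j..<Suc n]) ` {1..Suc n} \<subseteq> shuffle_perms n 1"
    by auto
  show "shuffle_perms n 1 \<subseteq> (\<lambda>j. word_perm [j..<Suc n]) ` {1..Suc n}"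
  proof
    fix s assume s: "s \<in> shuffle_perms n 1"
    have "s permutes {1..n + 1}"
      using s by (simp add: shuffle_perms_def)
    then have j: "1 \<le> s (n + 1)" "s (n + 1) \<le> Suc n"
      using permutes_in_image[of s "{1..n + 1}" "n + 1"] by auto
    have "s = word_perm [s (n + 1)..<Suc n]"
    proof (rule permutes_eq_if_mono_on_rest[of _ "{1..n + 1}" _ "n + 1"])
      show "s (n + 1) = word_perm [s (n + 1)..<Suc n] (n + 1)"
        using j by (simp only: word_perm_upt) simp
      show "strict_mono_on ({1..n + 1} - {n + 1}) s" "strict_mono_on ({1..n + 1} - {n + 1}) (word_perm [s (n + 1)..<Suc n])"
        unfolding rest using s cyc[OF j] unfolding shuffle_perms_def by blast+
    qed (use s cyc[OF j] in \<open>unfold shuffle_perms_def, auto\<close>)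
    then show "s \<in> (\<lambda>j. word_perm [j..<Suc n]) ` {1..Suc n}"
      using j by auto
  qed
qed

lemma inj_descending: "inj_on (\<lambda>j. word_perm (rev [1..<Suc j])) A"
proof (rule inj_onI)
  fix j k assume "word_perm (rev [1..<Suc j]) = word_perm (rev [1..<Suc k])"
  then show "j = k"
    using word_perm_rev_upt[of 1 "Suc j" 1] word_perm_rev_upt[of 1 "Suc k" 1] by (simp only:) simp
qed

lemma inj_ascending: "inj_on (\<lambda>j. word_perm [j..<c]) {a..c}"
proof (rule inj_onI)
  fix j k assume jk: "j \<in> {a..c}" "k \<in> {a..c}" and eq: "word_perm [j..<c] = word_perm [k..<c]"
  have "word_perm [j..<c] c = j" "word_perm [k..<c] c = k"
    using jk by (simp_all add: word_perm_upt)
  then show "j = k"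
    unfolding eq by simp
qed

section \<open>Endomorphism rings and whiskering\<close>

lemma (in abelian_group_hom) hom_finsum:
  assumes "finite A" "f \<in> A \<rightarrow> carrier G"
  shows "h (\<Oplus>\<^bsub>G\<^esub>i\<in>A. f i) = (\<Oplus>\<^bsub>H\<^esub>i\<in>A. h (f i))"
  using assms
proof (induction A)
  case (insert a A)
  then have "f a \<in> carrier G" "f \<in> A \<rightarrow> carrier G"
    by auto
  moreover from this have "(\<lambda>i. h (f i)) \<in> A \<rightarrow> carrier H"
    using hom_closed by (simp add: Pi_iff)
  ultimately show ?case
    using insert by (simp add: G.finsum_insert H.finsum_insert G.finsum_closed)
qed simp

lemma (in abelian_group_hom) hom_add_pow_int:
  fixes k :: int
  assumes "x \<in> carrier G"
  shows "h ([k] \<cdot>\<^bsub>G\<^esub> x) = [k] \<cdot>\<^bsub>H\<^esub> h x"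
  using group_hom.hom_int_pow[OF a_group_hom, of x k] assms by (simp add: add_pow_def)

context preadditive_category
begin

lemma comp_hom_left:
  assumes "A \<in> Ob C" "B \<in> Ob C" "D \<in> Ob C" "g \<in> mor C B D"
  shows "abelian_group_hom (Hom C A B) (Hom C A D) (\<lambda>f. g \<circ>\<^sub>c f)"
proof (rule abelian_group_homI)
  show "group_hom (add_monoid (Hom C A B)) (add_monoid (Hom C A D)) (\<lambda>f. g \<circ>\<^sub>c f)"
    using assms hom_abelian_group comp_closed comp_add_right unfolding mor_def
    by (intro group_hom.intro group_hom_axioms.intro homI abelian_group.a_group) auto
qed (use assms hom_abelian_group in auto)

lemma comp_hom_right:
  assumes "A \<in> Ob C" "B \<in> Ob C" "D \<in> Ob C" "f \<in> mor C A B"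
  shows "abelian_group_hom (Hom C B D) (Hom C A D) (\<lambda>g. g \<circ>\<^sub>c f)"
proof (rule abelian_group_homI)
  show "group_hom (add_monoid (Hom C B D)) (add_monoid (Hom C A D)) (\<lambda>g. g \<circ>\<^sub>c f)"
    using assms hom_abelian_group comp_closed comp_add_left unfolding mor_def
    by (intro group_hom.intro group_hom_axioms.intro homI abelian_group.a_group) auto
qed (use assms hom_abelian_group in auto)

text \<open>
  Overwriting the multiplicative fields of the hom-group, instead of building a new record, makes sums
  and negatives in \<open>endo_ring A\<close> literally those of the hom-group.
\<close>

definition endo_ring :: "'o \<Rightarrow> 'm ring" where
  "endo_ring A = (Hom C A A)\<lparr>monoid.mult := (\<circ>\<^sub>c), one := Id\<^sub>c A\<rparr>"

lemma endo_ring_simps [simp]: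
  "carrier (endo_ring A) = mor C A A"
  "f \<otimes>\<^bsub>endo_ring A\<^esub> g = f \<circ>\<^sub>c g"
  "\<one>\<^bsub>endo_ring A\<^esub> = Id\<^sub>c A"
  "f \<oplus>\<^bsub>endo_ring A\<^esub> g = f \<oplus>\<^bsub>Hom C A A\<^esub> g"
  "\<zero>\<^bsub>endo_ring A\<^esub> = \<zero>\<^bsub>Hom C A A\<^esub>"
  by (simp_all add: endo_ring_def mor_def)

lemma finsum_endo_ring: "finsum (endo_ring A) = finsum (Hom C A A)"
  by (simp add: finsum_def endo_ring_def)

lemma a_inv_endo_ring: "a_inv (endo_ring A) = a_inv (Hom C A A)"
  by (simp add: a_inv_def endo_ring_def)

lemma ring_endo_ring:
  assumes "A \<in> Ob C"
  shows "ring (endo_ring A)"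
proof (rule ringI)
  interpret H: abelian_group "Hom C A A"
    by (rule hom_abelian_group[OF assms assms])
  show "abelian_group (endo_ring A)"
    by (rule abelian_groupI)
      (auto simp: mor_def H.a_ac intro: bexI[of _ "\<ominus>\<^bsub>Hom C A A\<^esub> x" for x] H.l_neg)
  show "Group.monoid (endo_ring A)"
    using assms
    by (intro monoidI) (simp_all add: comp_closed ident_closed comp_ident_left comp_ident_right comp_assoc)
qed (use assms in \<open>auto simp: comp_add_left comp_add_right\<close>)

end

(* Left active, these rules would expand tensor_power C V 1. Powers are split by P_add instead. *)
declare tensor_power.simps [simp del]

locale tensor_powers = preadditive_strict_monoidal_category C for C :: "('o, 'm, 'x) monoidal_cat_scheme" (structure) +
  fixes V :: 'o
  assumes V_closed: "V \<in> Ob C"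
begin

abbreviation P :: "nat \<Rightarrow> 'o" where
  "P \<equiv> tensor_power C V"

abbreviation I :: "nat \<Rightarrow> 'm" where
  "I n \<equiv> Id\<^sub>c (P n)"

abbreviation endo :: "nat \<Rightarrow> 'm ring" where
  "endo n \<equiv> endo_ring (P n)"

lemma P_closed [simp]: "P n \<in> Ob C"
  by (induction n) (simp_all add: tensor_power.simps unit_closed tensor_ob_closed V_closed)

lemma P_add: "P (m + n) = P m \<otimes>\<^sub>o P n"
  by (induction m) (simp_all add: tensor_power.simps tensor_ob_unit_left tensor_ob_assoc V_closed)

lemma P_0: "P 0 = \<I>"
  by (simp add: tensor_power.simps)

lemma P_1: "P 1 = V"
  by (simp add: tensor_power.simps tensor_ob_unit_right V_closed)

lemma P_2: "P 2 = V \<otimes>\<^sub>o V"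
  by (simp add: numeral_2_eq_2 tensor_power.simps tensor_ob_unit_right V_closed)

lemma I_closed [simp]: "I n \<in> mor C (P n) (P n)"
  by (simp add: ident_closed)

lemma I_tensor: "I m \<otimes>\<^sub>m I n = I (m + n)"
  by (simp add: tensor_ident P_add)

lemmas P_comp_closed = comp_closed[OF P_closed P_closed P_closed]
lemmas P_comp_assoc = comp_assoc[OF P_closed P_closed P_closed P_closed]
lemmas P_ident_left = comp_ident_left[OF P_closed P_closed]
lemmas P_ident_right = comp_ident_right[OF P_closed P_closed]
lemmas P_tensor_comp = tensor_comp[OF P_closed P_closed P_closed P_closed P_closed P_closed]
lemmas P_tensor_assoc = tensor_mor_assoc[OF P_closed P_closed P_closed P_closed P_closed P_closed]
lemmas P_hom_group [simp] = hom_abelian_group[OF P_closed P_closed]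

lemma P_tensor_closed:
  assumes "f \<in> mor C (P k) (P l)" "g \<in> mor C (P m) (P n)"
  shows "f \<otimes>\<^sub>m g \<in> mor C (P (k + m)) (P (l + n))"
  using tensor_mor_closed[OF P_closed P_closed P_closed P_closed assms] by (simp add: P_add)

lemma tensor_square_closed:
  assumes "f \<in> mor C (P 0) (P 1)"
  shows "f \<otimes>\<^sub>m f \<in> mor C (P 0) (P 2)"
  using P_tensor_closed[OF assms assms] by (simp add: numeral_2_eq_2)

definition whisker :: "nat \<Rightarrow> nat \<Rightarrow> 'm \<Rightarrow> 'm" where
  "whisker a c \<phi> = I a \<otimes>\<^sub>m \<phi> \<otimes>\<^sub>m I c"

lemma act_at_eq_whisker: "act_at C V n l \<phi> i = whisker (i - 1) (n - (i - 1) - l) \<phi>"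
  by (simp add: act_at_def whisker_def)

lemma whisker_closed:
  assumes "\<phi> \<in> mor C (P l) (P r)" "m = a + l + c" "n = a + r + c"
  shows "whisker a c \<phi> \<in> mor C (P m) (P n)"
  using P_tensor_closed[OF I_closed P_tensor_closed[OF assms(1) I_closed], of a c] assms(2,3)
  by (simp add: whisker_def add.assoc)

lemma whisker_0_left: "\<phi> \<in> mor C (P l) (P r) \<Longrightarrow> whisker 0 c \<phi> = \<phi> \<otimes>\<^sub>m I c"
  unfolding whisker_def using tensor_mor_unit_left[OF P_closed P_closed P_tensor_closed[OF _ I_closed]]
  by (simp add: P_0)

lemma whisker_0_right: "\<phi> \<in> mor C (P l) (P r) \<Longrightarrow> whisker a 0 \<phi> = I a \<otimes>\<^sub>m \<phi>"
  unfolding whisker_def using tensor_mor_unit_right[OF P_closed P_closed]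
  by (simp add: P_0)

lemma whisker_0_0: "\<phi> \<in> mor C (P l) (P r) \<Longrightarrow> whisker 0 0 \<phi> = \<phi>"
  using whisker_0_left[of \<phi> l r 0] tensor_mor_unit_right[OF P_closed P_closed]
  by (simp add: P_0)

lemma whisker_comp:
  assumes "\<phi> \<in> mor C (P k) (P l)" "\<psi> \<in> mor C (P l) (P m)"
  shows "whisker a c (\<psi> \<circ>\<^sub>c \<phi>) = whisker a c \<psi> \<circ>\<^sub>c whisker a c \<phi>"
proof -
  have "(\<psi> \<circ>\<^sub>c \<phi>) \<otimes>\<^sub>m I c = (\<psi> \<otimes>\<^sub>m I c) \<circ>\<^sub>c (\<phi> \<otimes>\<^sub>m I c)"
    using P_tensor_comp[OF assms I_closed I_closed, of c] by (simp add: P_ident_left[OF I_closed])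
  moreover have "I a \<otimes>\<^sub>m ((\<psi> \<otimes>\<^sub>m I c) \<circ>\<^sub>c (\<phi> \<otimes>\<^sub>m I c)) = whisker a c \<psi> \<circ>\<^sub>c whisker a c \<phi>"
    using P_tensor_comp[OF I_closed I_closed P_tensor_closed[OF assms(1) I_closed]
        P_tensor_closed[OF assms(2) I_closed], of a c]
    by (simp add: whisker_def P_ident_left[OF I_closed])
  ultimately show ?thesis
    by (simp add: whisker_def)
qed

lemma whisker_whisker:
  assumes "\<phi> \<in> mor C (P l) (P r)"
  shows "whisker a c (whisker a' c' \<phi>) = whisker (a + a') (c' + c) \<phi>"
proof -
  have \<phi>c: "\<phi> \<otimes>\<^sub>m I n \<in> mor C (P (l + n)) (P (r + n))" for n
    by (intro P_tensor_closed assms I_closed)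
  have "whisker a' c' \<phi> \<otimes>\<^sub>m I c = I a' \<otimes>\<^sub>m (\<phi> \<otimes>\<^sub>m I (c' + c))"
    unfolding whisker_def
    by (simp add: P_tensor_assoc[OF I_closed \<phi>c I_closed] P_tensor_assoc[OF assms I_closed I_closed] I_tensor)
  then show ?thesis
    unfolding whisker_def by (simp add: I_tensor flip: P_tensor_assoc[OF I_closed I_closed \<phi>c])
qed

lemma tensor_interchange:
  assumes "\<phi> \<in> mor C (P k) (P l)" "\<psi> \<in> mor C (P m) (P n)"
  shows "(\<phi> \<otimes>\<^sub>m I n) \<circ>\<^sub>c (I k \<otimes>\<^sub>m \<psi>) = \<phi> \<otimes>\<^sub>m \<psi>"
    and "(I l \<otimes>\<^sub>m \<psi>) \<circ>\<^sub>c (\<phi> \<otimes>\<^sub>m I m) = \<phi> \<otimes>\<^sub>m \<psi>"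
  using P_tensor_comp[OF I_closed assms(1) assms(2) I_closed] P_tensor_comp[OF assms(1) I_closed I_closed assms(2)]
    assms by (simp_all add: P_ident_left P_ident_right)

text \<open>
  Morphisms that act on disjoint groups of strands commute, up to the change of position that \<open>\<phi>\<close>
  causes for what lies on its right. For two crossings this is the commutation of distant
  generators; for a crossing and a co-character it pushes the crossing through the inserted strand;
  for two co-characters it exchanges an insertion at the left with one at the right.
\<close>

lemma whisker_interchange:
  assumes \<phi>: "\<phi> \<in> mor C (P l) (P r)" and \<psi>: "\<psi> \<in> mor C (P l') (P r')"
    and "p = m + r' + c" "q = a + l + m" "q' = a + r + m" "p' = m + l' + c"
  shows "whisker a p \<phi> \<circ>\<^sub>c whisker q c \<psi> = whisker q' c \<psi> \<circ>\<^sub>c whisker a p' \<phi>"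
proof -
  let ?\<chi> = "whisker m c \<psi>"
  have \<chi>: "?\<chi> \<in> mor C (P p') (P p)"
    using assms by (intro whisker_closed[OF \<psi>]) auto
  have shift: "whisker (a + k + m) c \<psi> = whisker a 0 (I k \<otimes>\<^sub>m ?\<chi>)" for k
    using whisker_whisker[OF \<chi>, of a 0 k 0] whisker_whisker[OF \<psi>, of "a + k" 0 m c]
      whisker_0_right[OF \<chi>, of k] by simp
  have expand: "whisker a n \<phi> = whisker a 0 (\<phi> \<otimes>\<^sub>m I n)" for n
    using whisker_whisker[OF \<phi>, of a 0 0 n] whisker_0_left[OF \<phi>, of n] by simp
  have cl: "I k \<otimes>\<^sub>m ?\<chi> \<in> mor C (P (k + p')) (P (k + p))" "\<phi> \<otimes>\<^sub>m I n \<in> mor C (P (l + n)) (P (r + n))" for k n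
    by (intro P_tensor_closed \<phi> \<chi> I_closed)+
  have "whisker a p \<phi> \<circ>\<^sub>c whisker q c \<psi> = whisker a 0 (\<phi> \<otimes>\<^sub>m ?\<chi>)"
    unfolding assms(4) shift expand whisker_comp[OF cl, symmetric] tensor_interchange(1)[OF \<phi> \<chi>] ..
  moreover have "whisker q' c \<psi> \<circ>\<^sub>c whisker a p' \<phi> = whisker a 0 (\<phi> \<otimes>\<^sub>m ?\<chi>)"
    unfolding assms(5) shift expand whisker_comp[OF cl(2,1), symmetric] tensor_interchange(2)[OF \<phi> \<chi>] ..
  ultimately show ?thesis
    by simp
qed

lemma whisker_hom:
  "abelian_group_hom (Hom C (P l) (P r)) (Hom C (P (a + l + c)) (P (a + r + c))) (whisker a c)"
proof (rule abelian_group_homI)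
  let ?H = "Hom C (P l) (P r)" and ?K = "Hom C (P (a + l + c)) (P (a + r + c))"
  have add: "whisker a c (x \<oplus>\<^bsub>?H\<^esub> y) = whisker a c x \<oplus>\<^bsub>?K\<^esub> whisker a c y"
    if x: "x \<in> mor C (P l) (P r)" and y: "y \<in> mor C (P l) (P r)" for x y
  proof -
    note cl = P_tensor_closed[OF x I_closed, of c] P_tensor_closed[OF y I_closed, of c]
    show ?thesis
      using tensor_add_left[OF P_closed P_closed P_closed P_closed x y I_closed, of c]
        tensor_add_right[OF P_closed P_closed P_closed P_closed I_closed cl, of a]
      by (simp add: whisker_def P_add[symmetric] add.assoc)
  qed
  show "group_hom (add_monoid ?H) (add_monoid ?K) (whisker a c)"
    using add whisker_closed[of _ l r _ a c] unfolding mor_def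
    by (intro group_hom.intro group_hom_axioms.intro homI abelian_group.a_group) auto
qed auto

end

section \<open>The braid monoid acting on tensor powers\<close>

locale braided_object = tensor_powers C V for C :: "('o, 'm, 'x) monoidal_cat_scheme" (structure) and V +
  fixes \<beta> :: 'm
  assumes braiding_closed: "\<beta> \<in> mor C (P 2) (P 2)"
    and yang_baxter:
      "whisker 0 1 \<beta> \<circ>\<^sub>c whisker 1 0 \<beta> \<circ>\<^sub>c whisker 0 1 \<beta> =
       whisker 1 0 \<beta> \<circ>\<^sub>c whisker 0 1 \<beta> \<circ>\<^sub>c whisker 1 0 \<beta>"
begin

abbreviation gen :: "nat \<Rightarrow> nat \<Rightarrow> 'm" where
  "gen n \<equiv> act_at C V n 2 \<beta>"

lemma gen_closed:
  assumes "1 \<le> i" "i < n"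
  shows "gen n i \<in> mor C (P n) (P n)"
  unfolding act_at_eq_whisker by (rule whisker_closed[OF braiding_closed]) (use assms in auto)

lemma braid_family: "braid_family (endo (Suc N)) (gen (Suc N)) N"
proof -
  interpret ring "endo (Suc N)"
    by (simp add: ring_endo_ring)
  show ?thesis
  proof
    fix i assume "i \<in> {1..N}"
    then show "gen (Suc N) i \<in> carrier (endo (Suc N))"
      by (simp add: gen_closed)
  next
    fix i k assume ik: "1 \<le> i" "i + 2 \<le> k" "k \<le> N"
    then show "gen (Suc N) i \<otimes>\<^bsub>endo (Suc N)\<^esub> gen (Suc N) k = gen (Suc N) k \<otimes>\<^bsub>endo (Suc N)\<^esub> gen (Suc N) i"
      unfolding act_at_eq_whisker endo_ring_simps
      by (intro whisker_interchange[OF braiding_closed braiding_closed, of _ "k - i - 2"]) auto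
  next
    fix i assume i: "1 \<le> i" "Suc i \<le> N"
    define a c where "a = i - 1" and "c = N - i - 1"
    have ac: "i = Suc a" "N = a + 2 + c"
      using i by (auto simp: a_def c_def)
    have cl: "whisker 0 1 \<beta> \<in> mor C (P 3) (P 3)" "whisker 1 0 \<beta> \<in> mor C (P 3) (P 3)"
      by (auto intro!: whisker_closed[OF braiding_closed])
    have g: "gen (Suc N) i = whisker a c (whisker 0 1 \<beta>)" "gen (Suc N) (Suc i) = whisker a c (whisker 1 0 \<beta>)"
      unfolding whisker_whisker[OF braiding_closed] act_at_eq_whisker ac by simp_all
    show "gen (Suc N) i \<otimes>\<^bsub>endo (Suc N)\<^esub> (gen (Suc N) (Suc i) \<otimes>\<^bsub>endo (Suc N)\<^esub> gen (Suc N) i) =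
        gen (Suc N) (Suc i) \<otimes>\<^bsub>endo (Suc N)\<^esub> (gen (Suc N) i \<otimes>\<^bsub>endo (Suc N)\<^esub> gen (Suc N) (Suc i))"
      unfolding g endo_ring_simps
      using cl P_comp_closed[OF cl(1,2)] P_comp_closed[OF cl(2,1)] yang_baxter
      by (simp flip: whisker_comp[where k = 3 and l = 3 and m = 3])
  qed
qed

abbreviation ev :: "nat \<Rightarrow> nat list \<Rightarrow> 'm" where
  "ev n \<equiv> eval_word (endo n) (gen n)"

lemma ev_Nil: "ev n [] = I n"
  and ev_Cons: "ev n (i # w) = gen n i \<circ>\<^sub>c ev n w"
  by (simp_all add: eval_word_def)

lemma ev_closed: "set w \<subseteq> {1..<n} \<Longrightarrow> ev n w \<in> mor C (P n) (P n)"
  by (induction w) (auto simp: ev_Nil ev_Cons intro!: P_comp_closed gen_closed)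

lemma braid_lift_eq: "braid_lift C V \<beta> n s = ev n (arg_min length (expresses n s))"
  by (simp add: braid_lift_def eval_word_def)

lemma quantum_shuffle_left:
  "quantum_shuffle C V \<beta> 1 n =
    (\<Oplus>\<^bsub>endo (Suc n)\<^esub>j\<in>{..n}. ev (Suc n) (rev [1..<Suc j]))"
proof -
  interpret ring "endo (Suc n)"
    by (simp add: ring_endo_ring)
  have evj: "ev (Suc n) (rev [1..<Suc j]) \<in> mor C (P (Suc n)) (P (Suc n))" if "j \<le> n" for j
    using that by (intro ev_closed) auto
  have lift: "braid_lift C V \<beta> (Suc n) (word_perm (rev [1..<Suc j])) = ev (Suc n) (rev [1..<Suc j])"
    if "j \<le> n" for j
    unfolding braid_lift_eq using that by (subst shortest_descending) auto
  have "quantum_shuffle C V \<beta> 1 n =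
      finsum (endo (Suc n)) (braid_lift C V \<beta> (Suc n)) ((\<lambda>j. word_perm (rev [1..<Suc j])) ` {..n})"
    unfolding quantum_shuffle_def shuffle_perms_left finsum_endo_ring plus_1_eq_Suc ..
  also have "\<dots> = (\<Oplus>\<^bsub>endo (Suc n)\<^esub>j\<in>{..n}. braid_lift C V \<beta> (Suc n) (word_perm (rev [1..<Suc j])))"
    using lift evj by (intro finsum_reindex inj_descending) (force simp del: upt_Suc)
  also have "\<dots> = (\<Oplus>\<^bsub>endo (Suc n)\<^esub>j\<in>{..n}. ev (Suc n) (rev [1..<Suc j]))"
    using lift evj by (intro finsum_cong') (auto simp del: upt_Suc)
  finally show ?thesis .
qed

lemma quantum_shuffle_right:
  "quantum_shuffle C V \<beta> n 1 =
    (\<Oplus>\<^bsub>endo (Suc n)\<^esub>j\<in>{1..Suc n}. ev (Suc n) [j..<Suc n])"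
proof -
  interpret ring "endo (Suc n)"
    by (simp add: ring_endo_ring)
  have evj: "ev (Suc n) [j..<Suc n] \<in> mor C (P (Suc n)) (P (Suc n))" if "1 \<le> j" for j
    using that by (intro ev_closed) auto
  have lift: "braid_lift C V \<beta> (Suc n) (word_perm [j..<Suc n]) = ev (Suc n) [j..<Suc n]"
    if "1 \<le> j" "j \<le> Suc n" for j
    unfolding braid_lift_eq using that by (subst shortest_ascending) auto
  have "quantum_shuffle C V \<beta> n 1 =
      finsum (endo (Suc n)) (braid_lift C V \<beta> (Suc n)) ((\<lambda>j. word_perm [j..<Suc n]) ` {1..Suc n})"
    unfolding quantum_shuffle_def shuffle_perms_right finsum_endo_ring by simp
  also have "\<dots> = (\<Oplus>\<^bsub>endo (Suc n)\<^esub>j\<in>{1..Suc n}. braid_lift C V \<beta> (Suc n) (word_perm [j..<Suc n]))"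
    using lift evj by (intro finsum_reindex inj_ascending) (force simp del: upt_Suc)
  also have "\<dots> = (\<Oplus>\<^bsub>endo (Suc n)\<^esub>j\<in>{1..Suc n}. ev (Suc n) [j..<Suc n])"
    using lift evj by (intro finsum_cong') (auto simp del: upt_Suc)
  finally show ?thesis .
qed

text \<open>
  Here \<open>x\<close> will insert a strand, and \<open>h\<close> is the effect of this on the positions of the crossings: the
  successor for an insertion at the left, the identity for one at the right.
\<close>

lemma ev_push:
  assumes x: "x \<in> mor C (P n) (P n')"
    and h: "\<And>i. i \<in> {1..<n} \<Longrightarrow> h i \<in> {1..<n'} \<and> x \<circ>\<^sub>c gen n i = gen n' (h i) \<circ>\<^sub>c x"
    and w: "set w \<subseteq> {1..<n}"
  shows "x \<circ>\<^sub>c ev n w = ev n' (map h w) \<circ>\<^sub>c x"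
  using w
proof (induction w)
  case Nil
  then show ?case
    using x by (simp add: ev_Nil P_ident_left P_ident_right)
next
  case (Cons i w)
  then have i: "gen n i \<in> mor C (P n) (P n)" "gen n' (h i) \<in> mor C (P n') (P n')"
      "x \<circ>\<^sub>c gen n i = gen n' (h i) \<circ>\<^sub>c x"
    using h[of i] by (auto intro: gen_closed)
  have "set (map h w) \<subseteq> {1..<n'}"
    using Cons.prems h by fastforce
  from ev_closed[OF this] have w: "ev n w \<in> mor C (P n) (P n)" "ev n' (map h w) \<in> mor C (P n') (P n')"
    using Cons.prems ev_closed[of w n] by auto
  have "x \<circ>\<^sub>c ev n (i # w) = (gen n' (h i) \<circ>\<^sub>c x) \<circ>\<^sub>c ev n w"
    unfolding ev_Cons i(3)[symmetric] by (rule P_comp_assoc[OF w(1) i(1) x, symmetric])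
  also have "\<dots> = gen n' (h i) \<circ>\<^sub>c (ev n' (map h w) \<circ>\<^sub>c x)"
    using Cons P_comp_assoc[OF w(1) x i(2)] by simp
  also have "\<dots> = ev n' (map h (i # w)) \<circ>\<^sub>c x"
    by (simp add: ev_Cons P_comp_assoc[OF x w(2) i(2)])
  finally show ?case .
qed

lemma ev_sum_push:
  assumes x: "x \<in> mor C (P n) (P n')"
    and h: "\<And>i. i \<in> {1..<n} \<Longrightarrow> h i \<in> {1..<n'} \<and> x \<circ>\<^sub>c gen n i = gen n' (h i) \<circ>\<^sub>c x"
    and w: "finite J" "\<And>j. j \<in> J \<Longrightarrow> set (w j) \<subseteq> {1..<n}"
  shows "x \<circ>\<^sub>c (\<Oplus>\<^bsub>endo n\<^esub>j\<in>J. ev n (w j)) = (\<Oplus>\<^bsub>endo n'\<^esub>j\<in>J. ev n' (map h (w j))) \<circ>\<^sub>c x"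
proof -
  interpret l: abelian_group_hom "Hom C (P n) (P n)" "Hom C (P n) (P n')" "\<lambda>f. x \<circ>\<^sub>c f"
    by (rule comp_hom_left) (simp_all add: x)
  interpret r: abelian_group_hom "Hom C (P n') (P n')" "Hom C (P n) (P n')" "\<lambda>g. g \<circ>\<^sub>c x"
    by (rule comp_hom_right) (simp_all add: x)
  have w': "set (map h (w j)) \<subseteq> {1..<n'}" if "j \<in> J" for j
    using w(2)[OF that] h by fastforce
  have cl: "ev n (w j) \<in> mor C (P n) (P n)" "ev n' (map h (w j)) \<in> mor C (P n') (P n')" if "j \<in> J" for j
    using ev_closed[OF w(2)[OF that]] ev_closed[OF w'[OF that]] by auto
  have "x \<circ>\<^sub>c (\<Oplus>\<^bsub>endo n\<^esub>j\<in>J. ev n (w j)) = (\<Oplus>\<^bsub>Hom C (P n) (P n')\<^esub>j\<in>J. x \<circ>\<^sub>c ev n (w j))"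
    unfolding finsum_endo_ring using w cl by (intro l.hom_finsum) (auto simp: mor_def)
  also have "\<dots> = (\<Oplus>\<^bsub>Hom C (P n) (P n')\<^esub>j\<in>J. ev n' (map h (w j)) \<circ>\<^sub>c x)"
    using w cl ev_push[OF x h] P_comp_closed[OF x]
    by (intro l.H.finsum_cong') (auto simp: mor_def)
  also have "\<dots> = (\<Oplus>\<^bsub>endo n'\<^esub>j\<in>J. ev n' (map h (w j))) \<circ>\<^sub>c x"
    unfolding finsum_endo_ring using w cl by (intro r.hom_finsum[symmetric]) (auto simp: mor_def)
  finally show ?thesis .
qed

lemma quantum_shuffle_closed:
  "quantum_shuffle C V \<beta> 1 n \<in> mor C (P (Suc n)) (P (Suc n))"
  "quantum_shuffle C V \<beta> n 1 \<in> mor C (P (Suc n)) (P (Suc n))"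
proof -
  interpret ring "endo (Suc n)"
    by (simp add: ring_endo_ring)
  have "ev (Suc n) (rev [1..<Suc j]) \<in> carrier (endo (Suc n))" if "j \<le> n" for j
    unfolding endo_ring_simps using that by (intro ev_closed) auto
  then have "quantum_shuffle C V \<beta> 1 n \<in> carrier (endo (Suc n))"
    unfolding quantum_shuffle_left by (intro finsum_closed) auto
  moreover have "ev (Suc n) [j..<Suc n] \<in> carrier (endo (Suc n))" if "1 \<le> j" for j
    unfolding endo_ring_simps using that by (intro ev_closed) auto
  then have "quantum_shuffle C V \<beta> n 1 \<in> carrier (endo (Suc n))"
    unfolding quantum_shuffle_right by (intro finsum_closed) auto
  ultimately show "quantum_shuffle C V \<beta> 1 n \<in> mor C (P (Suc n)) (P (Suc n))"
    "quantum_shuffle C V \<beta> n 1 \<in> mor C (P (Suc n)) (P (Suc n))"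
    by simp_all
qed

section \<open>The two differentials\<close>

lemma insert_left_gen:
  assumes e: "e \<in> mor C (P 0) (P 1)" and "i \<in> {1..<n}"
  shows "whisker 0 n e \<circ>\<^sub>c gen n i = gen (Suc n) (Suc i) \<circ>\<^sub>c whisker 0 n e"
proof -
  have "Suc n - (Suc i - 1) - 2 = n - (i - 1) - 2"
    using assms(2) by auto
  then show ?thesis
    unfolding act_at_eq_whisker using assms(2)
    by (simp only:) (rule whisker_interchange[OF e braiding_closed, of _ "i - 1"]; auto)
qed

lemma insert_right_gen:
  assumes f: "f \<in> mor C (P 0) (P 1)" and "i \<in> {1..<n}"
  shows "whisker n 0 f \<circ>\<^sub>c gen n i = gen (Suc n) i \<circ>\<^sub>c whisker n 0 f"
  unfolding act_at_eq_whisker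
  by (rule whisker_interchange[OF braiding_closed f, of _ "n - (i - 1) - 2", symmetric]) (use assms in auto)

lemma insert_left_shuffle_left:
  assumes e: "e \<in> mor C (P 0) (P 1)"
  shows "whisker 0 (Suc n) e \<circ>\<^sub>c quantum_shuffle C V \<beta> 1 n =
    (\<Oplus>\<^bsub>endo (Suc (Suc n))\<^esub>j\<in>{..n}. ev (Suc (Suc n)) (rev [2..<j + 2])) \<circ>\<^sub>c whisker 0 (Suc n) e"
proof -
  have "map Suc (rev [1..<Suc j]) = rev [2..<j + 2]" for j
    by (simp add: map_Suc_upt numeral_2_eq_2 flip: rev_map)
  then show ?thesis
    unfolding quantum_shuffle_left
    using ev_sum_push[OF whisker_closed[OF e], of "Suc n" 0 "Suc n" "Suc (Suc n)" Suc "{..n}" "\<lambda>j. rev [1..<Suc j]"]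
      insert_left_gen[OF e] by (simp del: upt_Suc)
qed

lemma insert_left_shuffle_right:
  assumes e: "e \<in> mor C (P 0) (P 1)"
  shows "whisker 0 (Suc n) e \<circ>\<^sub>c quantum_shuffle C V \<beta> n 1 =
    (\<Oplus>\<^bsub>endo (Suc (Suc n))\<^esub>j\<in>{1..Suc n}. ev (Suc (Suc n)) [Suc j..<Suc (Suc n)]) \<circ>\<^sub>c whisker 0 (Suc n) e"
  unfolding quantum_shuffle_right map_Suc_upt[symmetric]
  by (rule ev_sum_push[OF whisker_closed[OF e]]) (use insert_left_gen[OF e] in auto)

lemma insert_right_shuffle_left:
  assumes f: "f \<in> mor C (P 0) (P 1)"
  shows "whisker (Suc n) 0 f \<circ>\<^sub>c quantum_shuffle C V \<beta> 1 n =
    (\<Oplus>\<^bsub>endo (Suc (Suc n))\<^esub>j\<in>{..n}. ev (Suc (Suc n)) (rev [1..<Suc j])) \<circ>\<^sub>c whisker (Suc n) 0 f"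
  unfolding quantum_shuffle_left
  by (rule ev_sum_push[OF whisker_closed[OF f], where h = "\<lambda>i. i", unfolded list.map_ident])
    (use insert_right_gen[OF f] in auto)

lemma insert_right_shuffle_right:
  assumes f: "f \<in> mor C (P 0) (P 1)"
  shows "whisker (Suc n) 0 f \<circ>\<^sub>c quantum_shuffle C V \<beta> n 1 =
    (\<Oplus>\<^bsub>endo (Suc (Suc n))\<^esub>j\<in>{1..Suc n}. ev (Suc (Suc n)) [j..<Suc n]) \<circ>\<^sub>c whisker (Suc n) 0 f"
  unfolding quantum_shuffle_right
  by (rule ev_sum_push[OF whisker_closed[OF f], where h = "\<lambda>i. i", unfolded list.map_ident])
    (use insert_right_gen[OF f] in auto)

text \<open>
  Each composite of two differentials is an insertion, a shuffle, an insertion and a shuffle. This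
  form gathers the two insertions on one side and the two shuffles on the other.
\<close>

lemma comp_slide:
  assumes "x \<in> mor C (P k) (P l)" "s \<in> mor C (P l) (P l)" "y \<in> mor C (P l) (P m)"
    and "t \<in> mor C (P m) (P m)" "s' \<in> mor C (P m) (P m)" "y \<circ>\<^sub>c s = s' \<circ>\<^sub>c y"
  shows "(t \<circ>\<^sub>c y) \<circ>\<^sub>c (s \<circ>\<^sub>c x) = (t \<circ>\<^sub>c s') \<circ>\<^sub>c (y \<circ>\<^sub>c x)"
proof -
  note sx = P_comp_closed[OF assms(1,2)] and yx = P_comp_closed[OF assms(1,3)]
  have "(t \<circ>\<^sub>c y) \<circ>\<^sub>c (s \<circ>\<^sub>c x) = t \<circ>\<^sub>c ((y \<circ>\<^sub>c s) \<circ>\<^sub>c x)"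
    by (simp only: P_comp_assoc[OF sx assms(3,4)] P_comp_assoc[OF assms(1,2,3)])
  also have "\<dots> = (t \<circ>\<^sub>c s') \<circ>\<^sub>c (y \<circ>\<^sub>c x)"
    by (simp only: assms(6) P_comp_assoc[OF yx assms(5,4)] P_comp_assoc[OF assms(1,3,5)])
  finally show ?thesis .
qed

lemma comp_one_plus_kills:
  assumes "x \<in> mor C (P k) (P m)" "b \<in> mor C (P m) (P m)" "Q \<in> mor C (P m) (P m)"
    and "b \<circ>\<^sub>c x = \<ominus>\<^bsub>Hom C (P k) (P m)\<^esub> x"
  shows "(Q \<circ>\<^sub>c (I m \<oplus>\<^bsub>Hom C (P m) (P m)\<^esub> b)) \<circ>\<^sub>c x = \<zero>\<^bsub>Hom C (P k) (P m)\<^esub>"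
proof -
  interpret E: abelian_group "Hom C (P m) (P m)"
    by simp
  interpret l: abelian_group_hom "Hom C (P k) (P m)" "Hom C (P k) (P m)" "\<lambda>f. Q \<circ>\<^sub>c f"
    by (rule comp_hom_left) (simp_all add: assms)
  interpret r: abelian_group_hom "Hom C (P m) (P m)" "Hom C (P k) (P m)" "\<lambda>g. g \<circ>\<^sub>c x"
    by (rule comp_hom_right) (simp_all add: assms)
  have cl: "x \<in> carrier (Hom C (P k) (P m))" "I m \<in> carrier (Hom C (P m) (P m))" "b \<in> carrier (Hom C (P m) (P m))"
    using assms I_closed by (simp_all add: mor_def)
  then have Ib: "I m \<oplus>\<^bsub>Hom C (P m) (P m)\<^esub> b \<in> mor C (P m) (P m)"
    by (simp add: mor_def)
  have "(I m \<oplus>\<^bsub>Hom C (P m) (P m)\<^esub> b) \<circ>\<^sub>c x = \<zero>\<^bsub>Hom C (P k) (P m)\<^esub>"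
    using r.hom_add[OF cl(2,3)] cl assms by (simp add: P_ident_left l.G.r_neg)
  then show ?thesis
    using P_comp_assoc[OF assms(1) Ib assms(3)] l.hom_zero by simp
qed

text \<open>
  For \<open>\<beta> = -\<sigma>\<close> these are the two differentials of the theorem, the right one without its sign \<open>(-1)^n\<close>.
  Without the sign they commute with each other; the sign makes them anticommute.
\<close>

definition left_map :: "'m \<Rightarrow> nat \<Rightarrow> 'm" where
  "left_map e n = quantum_shuffle C V \<beta> 1 n \<circ>\<^sub>c whisker 0 n e"

definition right_map :: "'m \<Rightarrow> nat \<Rightarrow> 'm" where
  "right_map f n = quantum_shuffle C V \<beta> n 1 \<circ>\<^sub>c whisker n 0 f"

lemma left_map_closed: "e \<in> mor C (P 0) (P 1) \<Longrightarrow> left_map e n \<in> mor C (P n) (P (Suc n))"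
  unfolding left_map_def by (rule P_comp_closed[OF whisker_closed quantum_shuffle_closed(1)]) auto

lemma right_map_closed: "f \<in> mor C (P 0) (P 1) \<Longrightarrow> right_map f n \<in> mor C (P n) (P (Suc n))"
  unfolding right_map_def by (rule P_comp_closed[OF whisker_closed quantum_shuffle_closed(2)]) auto

lemma whisker_anti_invariant:
  assumes x: "x \<in> mor C (P 0) (P 2)" and neg: "\<beta> \<circ>\<^sub>c x = \<ominus>\<^bsub>Hom C (P 0) (P 2)\<^esub> x"
    and n: "n = a + c"
  shows "whisker a c \<beta> \<circ>\<^sub>c whisker a c x = \<ominus>\<^bsub>Hom C (P n) (P (n + 2))\<^esub> whisker a c x"
proof -
  interpret w: abelian_group_hom "Hom C (P 0) (P 2)" "Hom C (P (a + 0 + c)) (P (a + 2 + c))" "whisker a c"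
    by (rule whisker_hom)
  have "a + 2 + c = n + 2" "a + 0 + c = n"
    using n by auto
  then show ?thesis
    using w.hom_a_inv[of x] x by (simp add: neg mor_def flip: whisker_comp[OF x braiding_closed])
qed

lemma insert_left_twice:
  assumes e: "e \<in> mor C (P 0) (P 1)"
  shows "whisker 0 (Suc n) e \<circ>\<^sub>c whisker 0 n e = whisker 0 n (e \<otimes>\<^sub>m e)"
proof -
  have "e \<otimes>\<^sub>m e = whisker 0 1 e \<circ>\<^sub>c whisker 0 0 e"
    using tensor_interchange(1)[OF e e] whisker_0_left[OF e, of 1] whisker_0_0[OF e]
      whisker_0_right[OF e, of 0] by simp
  moreover have "whisker 0 1 e \<in> mor C (P 1) (P 2)" "whisker 0 0 e \<in> mor C (P 0) (P 1)"
    by (auto intro!: whisker_closed[OF e])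
  ultimately show ?thesis
    by (simp add: whisker_comp[of _ 0 1 _ 2] whisker_whisker[OF e])
qed

lemma insert_right_twice:
  assumes f: "f \<in> mor C (P 0) (P 1)"
  shows "whisker (Suc n) 0 f \<circ>\<^sub>c whisker n 0 f = whisker n 0 (f \<otimes>\<^sub>m f)"
proof -
  have "f \<otimes>\<^sub>m f = whisker 1 0 f \<circ>\<^sub>c whisker 0 0 f"
    using tensor_interchange(2)[OF f f] whisker_0_right[OF f, of 1] whisker_0_0[OF f]
      whisker_0_left[OF f, of 0] by simp
  moreover have "whisker 1 0 f \<in> mor C (P 1) (P 2)" "whisker 0 0 f \<in> mor C (P 0) (P 1)"
    by (auto intro!: whisker_closed[OF f])
  ultimately show ?thesis
    by (simp add: whisker_comp[of _ 0 1 _ 2] whisker_whisker[OF f])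
qed

lemma left_map_square:
  assumes e: "e \<in> mor C (P 0) (P 1)"
    and neg: "\<beta> \<circ>\<^sub>c (e \<otimes>\<^sub>m e) = \<ominus>\<^bsub>Hom C (P 0) (P 2)\<^esub> (e \<otimes>\<^sub>m e)"
  shows "left_map e (n + 1) \<circ>\<^sub>c left_map e n = \<zero>\<^bsub>Hom C (P n) (P (n + 2))\<^esub>"
proof -
  define N where "N = Suc n"
  interpret bf: braid_family "endo (Suc N)" "gen (Suc N)" N
    by (rule braid_family)
  let ?D = "\<Oplus>\<^bsub>endo (Suc N)\<^esub>j\<in>{..N}. bf.descent j" and ?S = "\<Oplus>\<^bsub>endo (Suc N)\<^esub>j\<in>{..<N}. bf.shifted_descent j"
  have ee: "e \<otimes>\<^sub>m e \<in> mor C (P 0) (P 2)"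
    by (rule tensor_square_closed[OF e])
  have D: "quantum_shuffle C V \<beta> 1 N = ?D"
    unfolding quantum_shuffle_left bf.descent_def ..
  have S: "?S \<in> mor C (P (Suc N)) (P (Suc N))"
    using bf.finsum_closed[of bf.shifted_descent "{..<N}"] bf.shifted_descent_closed by auto
  have push: "whisker 0 N e \<circ>\<^sub>c quantum_shuffle C V \<beta> 1 n = ?S \<circ>\<^sub>c whisker 0 N e"
    unfolding N_def insert_left_shuffle_left[OF e] bf.shifted_descent_def[unfolded N_def] lessThan_Suc_atMost ..
  obtain Q where Q: "Q \<in> mor C (P (Suc N)) (P (Suc N))"
      "?D \<circ>\<^sub>c ?S = Q \<circ>\<^sub>c (I (Suc N) \<oplus>\<^bsub>Hom C (P (Suc N)) (P (Suc N))\<^esub> gen (Suc N) 1)"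
    using bf.descent_sum_factor by (auto simp: N_def)
  have "left_map e N \<circ>\<^sub>c left_map e n = (?D \<circ>\<^sub>c ?S) \<circ>\<^sub>c (whisker 0 N e \<circ>\<^sub>c whisker 0 n e)"
    unfolding left_map_def D[symmetric]
    by (rule comp_slide[OF whisker_closed[OF e] _ whisker_closed[OF e] _ S push])
      (use quantum_shuffle_closed in \<open>auto simp: N_def\<close>)
  also have "\<dots> = (Q \<circ>\<^sub>c (I (Suc N) \<oplus>\<^bsub>Hom C (P (Suc N)) (P (Suc N))\<^esub> gen (Suc N) 1)) \<circ>\<^sub>c whisker 0 n (e \<otimes>\<^sub>m e)"
    unfolding Q(2) using insert_left_twice[OF e, of n] by (simp add: N_def)
  also have "\<dots> = \<zero>\<^bsub>Hom C (P n) (P (Suc N))\<^esub>"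
  proof (rule comp_one_plus_kills[OF whisker_closed[OF ee] gen_closed Q(1)])
    have "gen (Suc N) 1 = whisker 0 n \<beta>"
      by (simp add: act_at_eq_whisker N_def)
    then show "gen (Suc N) 1 \<circ>\<^sub>c whisker 0 n (e \<otimes>\<^sub>m e) = \<ominus>\<^bsub>Hom C (P n) (P (Suc N))\<^esub> whisker 0 n (e \<otimes>\<^sub>m e)"
      using whisker_anti_invariant[OF ee neg, of n 0 n] by (simp add: N_def)
  qed (auto simp: N_def)
  finally show ?thesis
    by (simp add: N_def)
qed

lemma right_map_square:
  assumes f: "f \<in> mor C (P 0) (P 1)"
    and neg: "\<beta> \<circ>\<^sub>c (f \<otimes>\<^sub>m f) = \<ominus>\<^bsub>Hom C (P 0) (P 2)\<^esub> (f \<otimes>\<^sub>m f)"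
  shows "right_map f (n + 1) \<circ>\<^sub>c right_map f n = \<zero>\<^bsub>Hom C (P n) (P (n + 2))\<^esub>"
proof -
  define N where "N = Suc n"
  interpret bf: braid_family "endo (Suc N)" "gen (Suc N)" N
    by (rule braid_family)
  let ?A = "\<Oplus>\<^bsub>endo (Suc N)\<^esub>j\<in>{1..Suc N}. bf.ascent j" and ?S = "\<Oplus>\<^bsub>endo (Suc N)\<^esub>j\<in>{1..N}. ev (Suc N) [j..<N]"
  have ff: "f \<otimes>\<^sub>m f \<in> mor C (P 0) (P 2)"
    by (rule tensor_square_closed[OF f])
  have A: "quantum_shuffle C V \<beta> N 1 = ?A"
    unfolding quantum_shuffle_right bf.ascent_def ..
  have "ev (Suc N) [j..<N] \<in> carrier (endo (Suc N))" if "1 \<le> j" for j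
    unfolding endo_ring_simps using that by (intro ev_closed) auto
  then have S: "?S \<in> mor C (P (Suc N)) (P (Suc N))"
    using bf.finsum_closed[of "\<lambda>j. ev (Suc N) [j..<N]" "{1..N}"] by auto
  have push: "whisker N 0 f \<circ>\<^sub>c quantum_shuffle C V \<beta> n 1 = ?S \<circ>\<^sub>c whisker N 0 f"
    unfolding N_def by (rule insert_right_shuffle_right[OF f])
  obtain Q where Q: "Q \<in> mor C (P (Suc N)) (P (Suc N))"
      "?A \<circ>\<^sub>c ?S = Q \<circ>\<^sub>c (I (Suc N) \<oplus>\<^bsub>Hom C (P (Suc N)) (P (Suc N))\<^esub> gen (Suc N) N)"
    using bf.ascent_sum_factor by (auto simp: N_def simp del: upt_Suc)
  have "right_map f N \<circ>\<^sub>c right_map f n = (?A \<circ>\<^sub>c ?S) \<circ>\<^sub>c (whisker N 0 f \<circ>\<^sub>c whisker n 0 f)"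
    unfolding right_map_def A[symmetric]
    by (rule comp_slide[OF whisker_closed[OF f] _ whisker_closed[OF f] _ S push])
      (use quantum_shuffle_closed in \<open>auto simp: N_def\<close>)
  also have "\<dots> = (Q \<circ>\<^sub>c (I (Suc N) \<oplus>\<^bsub>Hom C (P (Suc N)) (P (Suc N))\<^esub> gen (Suc N) N)) \<circ>\<^sub>c whisker n 0 (f \<otimes>\<^sub>m f)"
    unfolding Q(2) using insert_right_twice[OF f, of n] by (simp add: N_def)
  also have "\<dots> = \<zero>\<^bsub>Hom C (P n) (P (Suc N))\<^esub>"
  proof (rule comp_one_plus_kills[OF whisker_closed[OF ff] gen_closed Q(1)])
    have "gen (Suc N) N = whisker n 0 \<beta>"
      by (simp add: act_at_eq_whisker N_def)
    then show "gen (Suc N) N \<circ>\<^sub>c whisker n 0 (f \<otimes>\<^sub>m f) = \<ominus>\<^bsub>Hom C (P n) (P (Suc N))\<^esub> whisker n 0 (f \<otimes>\<^sub>m f)"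
      using whisker_anti_invariant[OF ff neg, of n n 0] by (simp add: N_def)
  qed (auto simp: N_def)
  finally show ?thesis
    by (simp add: N_def)
qed

lemma left_right_map_commute:
  assumes e: "e \<in> mor C (P 0) (P 1)" and f: "f \<in> mor C (P 0) (P 1)"
  shows "left_map e (n + 1) \<circ>\<^sub>c right_map f n = right_map f (n + 1) \<circ>\<^sub>c left_map e n"
proof -
  define N where "N = Suc n"
  interpret bf: braid_family "endo (Suc N)" "gen (Suc N)" N
    by (rule braid_family)
  let ?D = "\<Oplus>\<^bsub>endo (Suc N)\<^esub>j\<in>{..N}. bf.descent j" and ?D' = "\<Oplus>\<^bsub>endo (Suc N)\<^esub>j\<in>{..<N}. bf.descent j"
    and ?A = "\<Oplus>\<^bsub>endo (Suc N)\<^esub>j\<in>{1..Suc N}. bf.ascent j" and ?A' = "\<Oplus>\<^bsub>endo (Suc N)\<^esub>j\<in>{2..Suc N}. bf.ascent j"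
  have D: "quantum_shuffle C V \<beta> 1 N = ?D"
    unfolding quantum_shuffle_left bf.descent_def ..
  have A: "quantum_shuffle C V \<beta> N 1 = ?A"
    unfolding quantum_shuffle_right bf.ascent_def ..
  have D': "?D' \<in> mor C (P (Suc N)) (P (Suc N))"
    using bf.finsum_closed[of bf.descent "{..<N}"] bf.descent_closed by auto
  have A': "?A' \<in> mor C (P (Suc N)) (P (Suc N))"
    using bf.finsum_closed[of bf.ascent "{2..Suc N}"] bf.ascent_closed by auto
  have push_f: "whisker N 0 f \<circ>\<^sub>c quantum_shuffle C V \<beta> 1 n = ?D' \<circ>\<^sub>c whisker N 0 f"
    unfolding N_def insert_right_shuffle_left[OF f] bf.descent_def[unfolded N_def] lessThan_Suc_atMost ..
  have "?A' = (\<Oplus>\<^bsub>endo (Suc N)\<^esub>j\<in>Suc ` {1..N}. bf.ascent j)"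
    by (simp add: image_Suc_atLeastAtMost numeral_2_eq_2)
  also have "\<dots> = (\<Oplus>\<^bsub>endo (Suc N)\<^esub>j\<in>{1..N}. bf.ascent (Suc j))"
    using bf.ascent_closed by (intro bf.finsum_reindex) auto
  finally have push_e: "whisker 0 N e \<circ>\<^sub>c quantum_shuffle C V \<beta> n 1 = ?A' \<circ>\<^sub>c whisker 0 N e"
    unfolding N_def insert_left_shuffle_right[OF e] bf.ascent_def[unfolded N_def] by simp
  have "left_map e N \<circ>\<^sub>c right_map f n = (?D \<circ>\<^sub>c ?A') \<circ>\<^sub>c (whisker 0 N e \<circ>\<^sub>c whisker n 0 f)"
    unfolding left_map_def right_map_def D[symmetric]
    by (rule comp_slide[OF whisker_closed[OF f] _ whisker_closed[OF e] _ A' push_e])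
      (use quantum_shuffle_closed in \<open>auto simp: N_def\<close>)
  also have "?D \<circ>\<^sub>c ?A' = ?A \<circ>\<^sub>c ?D'"
    using bf.descents_ascents_exchange by simp
  also have "whisker 0 N e \<circ>\<^sub>c whisker n 0 f = whisker N 0 f \<circ>\<^sub>c whisker 0 n e"
    by (rule whisker_interchange[OF e f, of _ n]) (simp_all add: N_def)
  also have "(?A \<circ>\<^sub>c ?D') \<circ>\<^sub>c (whisker N 0 f \<circ>\<^sub>c whisker 0 n e) = right_map f N \<circ>\<^sub>c left_map e n"
    unfolding left_map_def right_map_def A[symmetric]
    by (rule comp_slide[OF whisker_closed[OF e] _ whisker_closed[OF f] _ D' push_f, symmetric])
      (use quantum_shuffle_closed in \<open>auto simp: N_def\<close>)
  finally show ?thesis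
    by (simp add: N_def)
qed

end

context tensor_powers
begin

lemma neg_braided_object:
  assumes "pre_braided C V \<sigma>"
  shows "braided_object C V (neg_braiding C V \<sigma>)"
proof
  have \<sigma>: "\<sigma> \<in> mor C (P 2) (P 2)"
    using assms by (simp add: pre_braided_def P_2)
  have neg: "neg_braiding C V \<sigma> = \<ominus>\<^bsub>Hom C (P 2) (P 2)\<^esub> \<sigma>"
    by (simp add: neg_braiding_def P_2)
  interpret E: abelian_group "Hom C (P 2) (P 2)"
    by simp
  interpret R: ring "endo 3"
    by (simp add: ring_endo_ring)
  show "neg_braiding C V \<sigma> \<in> mor C (P 2) (P 2)"
    using \<sigma> by (simp add: neg mor_def)
  interpret w1: abelian_group_hom "Hom C (P 2) (P 2)" "Hom C (P (0 + 2 + 1)) (P (0 + 2 + 1))" "whisker 0 1"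
    by (rule whisker_hom)
  interpret w2: abelian_group_hom "Hom C (P 2) (P 2)" "Hom C (P (1 + 2 + 0)) (P (1 + 2 + 0))" "whisker 1 0"
    by (rule whisker_hom)
  let ?x = "whisker 0 1 \<sigma>" and ?y = "whisker 1 0 \<sigma>"
  have cl: "?x \<in> carrier (endo 3)" "?y \<in> carrier (endo 3)"
    unfolding endo_ring_simps by (auto intro!: whisker_closed[OF \<sigma>])
  have n: "0 + 2 + 1 = (3 :: nat)" "1 + 2 + 0 = (3 :: nat)"
    by simp_all
  have w: "whisker 0 1 (neg_braiding C V \<sigma>) = \<ominus>\<^bsub>endo 3\<^esub> ?x"
      "whisker 1 0 (neg_braiding C V \<sigma>) = \<ominus>\<^bsub>endo 3\<^esub> ?y"
    unfolding neg a_inv_endo_ring using w1.hom_a_inv[of \<sigma>, unfolded n] w2.hom_a_inv[of \<sigma>, unfolded n] \<sigma>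
    by (simp_all add: mor_def)
  have "?x \<otimes>\<^bsub>endo 3\<^esub> (?y \<otimes>\<^bsub>endo 3\<^esub> ?x) = ?y \<otimes>\<^bsub>endo 3\<^esub> (?x \<otimes>\<^bsub>endo 3\<^esub> ?y)"
    using assms by (simp add: pre_braided_def act_at_eq_whisker Let_def)
  then have "\<ominus>\<^bsub>endo 3\<^esub> ?x \<otimes>\<^bsub>endo 3\<^esub> (\<ominus>\<^bsub>endo 3\<^esub> ?y \<otimes>\<^bsub>endo 3\<^esub> \<ominus>\<^bsub>endo 3\<^esub> ?x) =
      \<ominus>\<^bsub>endo 3\<^esub> ?y \<otimes>\<^bsub>endo 3\<^esub> (\<ominus>\<^bsub>endo 3\<^esub> ?x \<otimes>\<^bsub>endo 3\<^esub> \<ominus>\<^bsub>endo 3\<^esub> ?y)"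
    using cl by (simp only: R.l_minus R.r_minus R.m_closed R.minus_minus R.a_inv_closed)
  then show "whisker 0 1 (neg_braiding C V \<sigma>) \<circ>\<^sub>c whisker 1 0 (neg_braiding C V \<sigma>) \<circ>\<^sub>c whisker 0 1 (neg_braiding C V \<sigma>) =
      whisker 1 0 (neg_braiding C V \<sigma>) \<circ>\<^sub>c whisker 0 1 (neg_braiding C V \<sigma>) \<circ>\<^sub>c whisker 1 0 (neg_braiding C V \<sigma>)"
    unfolding w by simp
qed

lemma cocharacter_anti_invariant:
  assumes "pre_braided C V \<sigma>" "braided_cocharacter C V \<sigma> e"
  shows "e \<in> mor C (P 0) (P 1)"
    and "neg_braiding C V \<sigma> \<circ>\<^sub>c (e \<otimes>\<^sub>m e) = \<ominus>\<^bsub>Hom C (P 0) (P 2)\<^esub> (e \<otimes>\<^sub>m e)"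
proof -
  have \<sigma>: "\<sigma> \<in> mor C (P 2) (P 2)"
    using assms by (simp add: pre_braided_def P_2)
  show e: "e \<in> mor C (P 0) (P 1)"
    unfolding P_0 P_1 using assms by (simp add: braided_cocharacter_def)
  have ee: "e \<otimes>\<^sub>m e \<in> mor C (P 0) (P 2)"
    by (rule tensor_square_closed[OF e])
  interpret r: abelian_group_hom "Hom C (P 2) (P 2)" "Hom C (P 0) (P 2)" "\<lambda>g. g \<circ>\<^sub>c (e \<otimes>\<^sub>m e)"
    by (rule comp_hom_right) (simp_all add: ee)
  show "neg_braiding C V \<sigma> \<circ>\<^sub>c (e \<otimes>\<^sub>m e) = \<ominus>\<^bsub>Hom C (P 0) (P 2)\<^esub> (e \<otimes>\<^sub>m e)"
    using r.hom_a_inv[of \<sigma>] \<sigma> assms(2)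
    by (simp add: neg_braiding_def P_2 mor_def braided_cocharacter_def)
qed

end

theorem mainTheorem15:
  fixes C :: "('o, 'm) monoidal_cat" and V :: 'o and \<sigma> e f :: 'm
  assumes "preadditive_strict_monoidal_category C"
    and "pre_braided C V \<sigma>"
    and "braided_cocharacter C V \<sigma> e"
    and "braided_cocharacter C V \<sigma> f"
  shows "tensor_bidifferential C V (left_differential C V \<sigma> e) (right_differential C V \<sigma> f)"
proof -
  interpret preadditive_strict_monoidal_category C
    by (rule assms(1))
  interpret tensor_powers C V
    by unfold_locales (use assms(2) in \<open>simp add: pre_braided_def\<close>)
  interpret braided_object C V "neg_braiding C V \<sigma>"
    by (rule neg_braided_object[OF assms(2)])
  note e = cocharacter_anti_invariant[OF assms(2,3)] and f = cocharacter_anti_invariant[OF assms(2,4)]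
  let ?d = "left_map e" and ?r = "right_map f"
  have d: "left_differential C V \<sigma> e n = ?d n" for n
    unfolding left_differential_def left_map_def whisker_0_left[OF e(1)] ..
  have r: "right_differential C V \<sigma> f n = [((- 1 :: int) ^ n)] \<cdot>\<^bsub>Hom C (P n) (P (n + 1))\<^esub> ?r n" for n
    unfolding right_differential_def right_map_def whisker_0_right[OF f(1)] ..
  have dc: "?d n \<in> mor C (P n) (P (n + 1))" and rc: "?r n \<in> mor C (P n) (P (n + 1))" for n
    using left_map_closed[OF e(1)] right_map_closed[OF f(1)] by auto
  have sc: "[k] \<cdot>\<^bsub>Hom C (P n) (P (n + 1))\<^esub> ?r n \<in> mor C (P n) (P (n + 1))" for k :: int and n
  proof -
    interpret abelian_group "Hom C (P n) (P (n + 1))"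
      by simp
    show ?thesis
      using rc[of n] unfolding mor_def by (rule add.int_pow_closed)
  qed
  have "right_differential C V \<sigma> f (n + 1) \<circ>\<^sub>c\<^bsub>C\<^esub> right_differential C V \<sigma> f n = \<zero>\<^bsub>Hom C (P n) (P (n + 2))\<^esub>
      \<and> (right_differential C V \<sigma> f (n + 1) \<circ>\<^sub>c\<^bsub>C\<^esub> ?d n) \<oplus>\<^bsub>Hom C (P n) (P (n + 2))\<^esub>
        (?d (n + 1) \<circ>\<^sub>c\<^bsub>C\<^esub> right_differential C V \<sigma> f n) = \<zero>\<^bsub>Hom C (P n) (P (n + 2))\<^esub>" for n
  proof -
    let ?k = "(- 1 :: int) ^ n" and ?l = "(- 1 :: int) ^ (n + 1)"
    let ?H1 = "Hom C (P n) (P (n + 1))" and ?H2 = "Hom C (P (n + 1)) (P (n + 2))" and ?H = "Hom C (P n) (P (n + 2))"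
    have rc': "?r (n + 1) \<in> mor C (P (n + 1)) (P (n + 2))" and dc': "?d (n + 1) \<in> mor C (P (n + 1)) (P (n + 2))"
      using rc[of "n + 1"] dc[of "n + 1"] by simp_all
    interpret H: abelian_group ?H
      by simp
    interpret rl: abelian_group_hom ?H1 ?H "\<lambda>g. ?r (n + 1) \<circ>\<^sub>c\<^bsub>C\<^esub> g"
      by (rule comp_hom_left[OF P_closed P_closed P_closed rc'])
    interpret dl: abelian_group_hom ?H1 ?H "\<lambda>g. ?d (n + 1) \<circ>\<^sub>c\<^bsub>C\<^esub> g"
      by (rule comp_hom_left[OF P_closed P_closed P_closed dc'])
    interpret sr: abelian_group_hom ?H2 ?H "\<lambda>g. g \<circ>\<^sub>c\<^bsub>C\<^esub> ([?k] \<cdot>\<^bsub>?H1\<^esub> ?r n)"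
      by (rule comp_hom_right[OF P_closed P_closed P_closed sc])
    interpret dr: abelian_group_hom ?H2 ?H "\<lambda>g. g \<circ>\<^sub>c\<^bsub>C\<^esub> ?d n"
      by (rule comp_hom_right[OF P_closed P_closed P_closed dc])
    have r': "right_differential C V \<sigma> f (n + 1) = [?l] \<cdot>\<^bsub>?H2\<^esub> ?r (n + 1)"
      unfolding r by simp
    have "right_differential C V \<sigma> f (n + 1) \<circ>\<^sub>c\<^bsub>C\<^esub> right_differential C V \<sigma> f n
        = [?l] \<cdot>\<^bsub>?H\<^esub> ([?k] \<cdot>\<^bsub>?H\<^esub> (?r (n + 1) \<circ>\<^sub>c\<^bsub>C\<^esub> ?r n))"
      unfolding r' r[of n] sr.hom_add_pow_int[OF rc'[unfolded mor_def]]
        rl.hom_add_pow_int[OF rc[unfolded mor_def]] ..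
    also have "\<dots> = \<zero>\<^bsub>?H\<^esub>"
      unfolding right_map_square[OF f] by (simp only: H.add.int_pow_one)
    finally have rr: "right_differential C V \<sigma> f (n + 1) \<circ>\<^sub>c\<^bsub>C\<^esub> right_differential C V \<sigma> f n = \<zero>\<^bsub>?H\<^esub>" .
    have "?r (n + 1) \<circ>\<^sub>c\<^bsub>C\<^esub> ?d n \<in> carrier ?H"
      using P_comp_closed[OF dc[of n] rc'] by (simp add: mor_def)
    then have "[?l] \<cdot>\<^bsub>?H\<^esub> (?r (n + 1) \<circ>\<^sub>c\<^bsub>C\<^esub> ?d n) \<oplus>\<^bsub>?H\<^esub> [?k] \<cdot>\<^bsub>?H\<^esub> (?r (n + 1) \<circ>\<^sub>c\<^bsub>C\<^esub> ?d n)
        = [(?l + ?k)] \<cdot>\<^bsub>?H\<^esub> (?r (n + 1) \<circ>\<^sub>c\<^bsub>C\<^esub> ?d n)"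
      by (rule H.add.int_pow_mult[symmetric])
    also have "\<dots> = \<zero>\<^bsub>?H\<^esub>"
      by (simp add: add_pow_def)
    finally have "(right_differential C V \<sigma> f (n + 1) \<circ>\<^sub>c\<^bsub>C\<^esub> ?d n) \<oplus>\<^bsub>?H\<^esub>
        (?d (n + 1) \<circ>\<^sub>c\<^bsub>C\<^esub> right_differential C V \<sigma> f n) = \<zero>\<^bsub>?H\<^esub>"
      unfolding r' r[of n] dr.hom_add_pow_int[OF rc'[unfolded mor_def]]
        dl.hom_add_pow_int[OF rc[unfolded mor_def]] left_right_map_commute[OF e(1) f(1)] .
    then show ?thesis
      by (rule conjI[OF rr])
  qed
  moreover have "?d (n + 1) \<circ>\<^sub>c\<^bsub>C\<^esub> ?d n = \<zero>\<^bsub>Hom C (P n) (P (n + 2))\<^esub>" for n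
    by (rule left_map_square[OF e])
  moreover have "right_differential C V \<sigma> f n \<in> mor C (P n) (P (n + 1))" for n
    unfolding r by (rule sc)
  ultimately show ?thesis
    using dc unfolding tensor_bidifferential_def Let_def d by (intro conjI allI) simp_all
qed

end
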